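(* Let $\mathsf{GR}=\mathsf{GR}(p^e,d)$, let $(A_1,\dots,A_n)$ and $(B_1,\dots,B_n)$ be two batches of matrices with $A_i\in\mathsf{GR}^{t\times r}$ and $B_i\in\mathsf{GR}^{r\times s}$ for all $i$, let $N$ be the number of worker nodes, and let $u\mid t$, $v\mid s$, $w\mid r$ be positive integers such that $R:=uvw+w-1\le N$. Assume $m=\lceil(\log_p N)/d\rceil=O(n)$. Then the scheme Batch-$\widetilde{\mathsf{EP}}_{\mathsf{RMFE}}$ (defined in the context) computes $(A_1B_1,\dots,A_nB_n)$ with recovery threshold $R=uvw+w-1$. Moreover, its amortized costs (total cost divided by $n$, i.e. per matrix multiplication) are as follows. Amortized communication, counted in elements of $\mathsf{GR}$: - upload: $O\left(\left(\frac{tr}{uw}+\frac{rs}{wv}\right)N\right)$; - download: $O\left(\frac{ts}{uv}R\right)$. Amortized computation, counted in operations in $\mathsf{GR}$: - encoding: $\tilde O\left(\frac{trv+sru}{uvw}\,N\log^2 N\right)$; - decoding: $\tilde O\left(\frac{ts}{uv}\,R\log^2 R\right)$; - computation of each worker node: $\tilde O\left(\frac{trs}{uvw}\right)$.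
   Context: **Galois rings.** For a prime $p$ and integers $e,d\ge1$, $\mathsf{GR}(p^e,d)=\mathbb{Z}_{p^e}[x]/(f(x))$, where $f$ is monic of degree $d$ and irreducible modulo $p$. Write $\mathsf{GR}=\mathsf{GR}(p^e,d)$ and $\mathsf{GR}_k=\mathsf{GR}(p^e,dk)$, the extension of $\mathsf{GR}$ of degree $k$. An element of $\mathsf{GR}_k$ is represented by $k$ elements of $\mathsf{GR}$. A subset of a Galois ring is exceptional if the difference of any two distinct elements is invertible; $\mathsf{GR}_k$ has an exceptional set $T$ of size $p^{dk}$ (representatives modulo $p$). **RMFE.** An $(n,m)$-RMFE over $\mathsf{GR}$ is a pair $(\phi,\psi)$ of $\mathsf{GR}$-linear maps $\phi:\mathsf{GR}^n\to\mathsf{GR}_m$, $\psi:\mathsf{GR}_m\to\mathsf{GR}^n$ with $\psi(\phi(\mathbf x)\phi(\mathbf y))=\mathbf x\star\mathbf y$ for all $\mathbf x,\mathbf y\in\mathsf{GR}^n$, where $\star$ is the componentwise product. Standing assumption: an $(n,m)$-RMFE over $\mathsf{GR}$ is fixed such that each evaluation of $\phi$ or $\psi$ costs $O(m\log^2m\log\log m)$ operations in $\mathsf{GR}$. **Cost model and notation.** Costs are counted in operations in $\mathsf{GR}$ (computation) or elements of $\mathsf{GR}$ (communication). One arithmetic operation in $\mathsf{GR}_k$ costs $O(k\log^2k\log\log k)$ operations in $\mathsf{GR}$. Evaluating a polynomial of degree less than $\ell$ over a Galois ring at $\ell$ points of an exceptional set $T$, or interpolating such a polynomial from its values at those points, costs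 $O(\ell\log^2\ell\log\log\ell)$ operations in that ring. Worker nodes multiply an $a\times b$ by a $b\times c$ matrix using $O(abc)$ ring operations. $\tilde O$ omits factors polynomial in $\log\log N$. Here $p,e,d$ are fixed, and implied constants are independent of $t,r,s,u,v,w,n,N$ (they may depend on the constant in $m=O(n)$). $N\ge2$, and $\log x$, $\log\log x$ inside $O$/$\tilde O$ are read as at least $1$. **Distributed model.** A master node encodes the inputs and sends data to each of $N$ worker nodes (upload is the total amount sent). Each worker computes a local product and returns it. The recovery threshold is $R$ if the responses of any $R$ workers suffice for the master to recover the desired output. Download is the total amount received from $R$ workers. Encoding (resp. decoding) complexity is the cost of the master's computation before sending (resp. after receiving). **EP codes over $\mathsf{GR}_m$.** Given $\mathcal A\in\mathsf{GR}_m^{t\times r}$, $\mathcal B\in\mathsf{GR}_m^{r\times s}$, partition $\mathcal A=(\mathcal A_{ij})_{1\le i\le u,1\le j\le w}$ with blocks of size $\frac tu\times\frac rw$ and $\mathcal B=(\mathcal B_{k\ell})_{1\le k\le w,1\le\ell\le v}$ with blocks of size $\frac rw\times\frac sv$. Set $f(x)=\sum_{i,j}\mathcal A_{ij}x^{(i-1)w+j-1}$, $g(x)=\sum_{k,\ell}\mathcal B_{k\ell}x^{w-k+(\ell-1)uw}$. For $N\le p^{dm}$ distinct points $\alpha_1,\dots,\alpha_N$ of an exceptional set of $\mathsf{GR}_m$, the master sends $f(\alpha_i),g(\alpha_i)$ to worker $i$, who returns $h(\alpha_i)=f(\alpha_i)g(\alpha_i)$. The master interpolates $h=fg$ from $R$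 responses and reads the blocks $\sum_j\mathcal A_{ij}\mathcal B_{j\ell}$ of $\mathcal{AB}$ off the coefficients of $h$. **Batch-$\widetilde{\mathsf{EP}}_{\mathsf{RMFE}}$.** The master packs the batches into $\mathcal A\in\mathsf{GR}_m^{t\times r}$, $\mathcal B\in\mathsf{GR}_m^{r\times s}$ by $\mathcal A[i,j]=\phi(A_1[i,j],\dots,A_n[i,j])$ and $\mathcal B[k,\ell]=\phi(B_1[k,\ell],\dots,B_n[k,\ell])$ (part of encoding), runs EP codes over $\mathsf{GR}_m$ with parameters $u,v,w$ and $N$ workers to obtain $\mathcal C=\mathcal{AB}$, and outputs $C_1,\dots,C_n$ given by $(C_1[i,\ell],\dots,C_n[i,\ell])=\psi(\mathcal C[i,\ell])$ (part of decoding). *)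

theory Defs
  imports
    Complex_Main
    "HOL-Library.FuncSet"
    "HOL-Algebra.UnivPoly"
    "HOL-Algebra.QuotRing"
    "HOL-Algebra.Ring_Divisibility"
    "HOL-Number_Theory.Residues"
begin

section \<open>Galois rings\<close>

text \<open>The polynomial ring \<open>UP (residue_ring q)\<close> consists of functions \<open>nat \<Rightarrow> int\<close> with
  values in \<open>{0..q-1}\<close>, so reduction modulo \<open>p\<close> acts on the coefficients.\<close>

definition galois_modulus :: "nat \<Rightarrow> nat \<Rightarrow> nat \<Rightarrow> (nat \<Rightarrow> int) \<Rightarrow> bool" where
  "galois_modulus p e d f \<longleftrightarrow>
     f \<in> carrier (UP (residue_ring (int p ^ e))) \<and>
     deg (residue_ring (int p ^ e)) f = d \<and>
     coeff (UP (residue_ring (int p ^ e))) f d = \<one>\<^bsub>residue_ring (int p ^ e)\<^esub> \<and>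
     ring_irreducible\<^bsub>UP (residue_ring (int p))\<^esub> (\<lambda>i. f i mod int p)"

text \<open>\<open>galois_ring p e f\<close> is \<open>GR(p^e, d)\<close> whenever \<open>galois_modulus p e d f\<close> holds.\<close>

definition galois_ring :: "nat \<Rightarrow> nat \<Rightarrow> (nat \<Rightarrow> int) \<Rightarrow> (nat \<Rightarrow> int) set ring" where
  "galois_ring p e f =
     UP (residue_ring (int p ^ e)) Quot (PIdl\<^bsub>UP (residue_ring (int p ^ e))\<^esub> f)"

definition exceptional :: "('b, 'c) ring_scheme \<Rightarrow> 'b set \<Rightarrow> bool" where
  "exceptional S T \<longleftrightarrow>
     T \<subseteq> carrier S \<and> (\<forall>x\<in>T. \<forall>y\<in>T. x \<noteq> y \<longrightarrow> x \<ominus>\<^bsub>S\<^esub> y \<in> Units S)"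

section \<open>Linear maps, representation of an extension, RMFE\<close>

text \<open>The free module \<open>R\<^sup>n\<close>; its multiplication is the componentwise product.\<close>

definition vec_space :: "'a ring \<Rightarrow> nat \<Rightarrow> ('a, nat \<Rightarrow> 'a) module" where
  "vec_space R n = \<lparr>
     carrier = {..<n} \<rightarrow>\<^sub>E carrier R,
     mult = (\<lambda>x y. \<lambda>i\<in>{..<n}. x i \<otimes>\<^bsub>R\<^esub> y i),
     one = (\<lambda>i\<in>{..<n}. \<one>\<^bsub>R\<^esub>),
     zero = (\<lambda>i\<in>{..<n}. \<zero>\<^bsub>R\<^esub>),
     add = (\<lambda>x y. \<lambda>i\<in>{..<n}. x i \<oplus>\<^bsub>R\<^esub> y i),
     smult = (\<lambda>c x. \<lambda>i\<in>{..<n}. c \<otimes>\<^bsub>R\<^esub> x i)\<rparr>"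

definition ext_module :: "('a \<Rightarrow> 'b) \<Rightarrow> 'b ring \<Rightarrow> ('a, 'b) module" where
  "ext_module \<iota> S = \<lparr>
     carrier = carrier S, mult = mult S, one = one S, zero = zero S, add = add S,
     smult = (\<lambda>c x. \<iota> c \<otimes>\<^bsub>S\<^esub> x)\<rparr>"

definition linear_maps ::
    "'a ring \<Rightarrow> ('a, 'b) module \<Rightarrow> ('a, 'c) module \<Rightarrow> ('b \<Rightarrow> 'c) set" where
  "linear_maps R M M' = {h.
     h \<in> carrier M \<rightarrow> carrier M' \<and>
     (\<forall>x\<in>carrier M. \<forall>y\<in>carrier M. h (x \<oplus>\<^bsub>M\<^esub> y) = h x \<oplus>\<^bsub>M'\<^esub> h y) \<and>
     (\<forall>c\<in>carrier R. \<forall>x\<in>carrier M. h (c \<odot>\<^bsub>M\<^esub> x) = c \<odot>\<^bsub>M'\<^esub> h x)}"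

text \<open>\<open>S\<close> is a ring extension of \<open>R\<close> along \<open>\<iota>\<close>, and \<open>\<kappa>\<close> represents the elements of \<open>S\<close> by
  \<open>m\<close> elements of \<open>R\<close>: it is the coordinate map of an \<open>R\<close>-basis of \<open>S\<close>.\<close>

definition extension_of_degree ::
    "'a ring \<Rightarrow> 'b ring \<Rightarrow> ('a \<Rightarrow> 'b) \<Rightarrow> nat \<Rightarrow> ('b \<Rightarrow> nat \<Rightarrow> 'a) \<Rightarrow> bool" where
  "extension_of_degree R S \<iota> m \<kappa> \<longleftrightarrow>
     \<iota> \<in> ring_hom R S \<and>
     \<kappa> \<in> linear_maps R (ext_module \<iota> S) (vec_space R m) \<and>
     bij_betw \<kappa> (carrier S) (carrier (vec_space R m))"

definition rmfe ::
    "'a ring \<Rightarrow> 'b ring \<Rightarrow> ('a \<Rightarrow> 'b) \<Rightarrow> nat \<Rightarrow> ((nat \<Rightarrow> 'a) \<Rightarrow> 'b) \<Rightarrow> ('b \<Rightarrow> nat \<Rightarrow> 'a) \<Rightarrow> bool"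
  where
  "rmfe R S \<iota> n \<phi> \<psi> \<longleftrightarrow>
     \<phi> \<in> linear_maps R (vec_space R n) (ext_module \<iota> S) \<and>
     \<psi> \<in> linear_maps R (ext_module \<iota> S) (vec_space R n) \<and>
     (\<forall>x\<in>carrier (vec_space R n). \<forall>y\<in>carrier (vec_space R n).
        \<psi> (\<phi> x \<otimes>\<^bsub>S\<^esub> \<phi> y) = x \<otimes>\<^bsub>vec_space R n\<^esub> y)"

section \<open>Counting ring operations\<close>

text \<open>Computations are straight-line programs over a ring \<open>R\<close>, with inputs named by an
  arbitrary type and results stored in consecutive registers. The cost is the number of
  arithmetic operations; constants of \<open>R\<close> are free. A model with branching or table lookup
  would be degenerate: over a fixed finite ring, a decision tree with free constants
  evaluates every function in as many steps as it has inputs.\<close>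

datatype ('i, 'a) operand = Input 'i | Const 'a | Reg nat

datatype ('i, 'a) instr =
    Add "('i, 'a) operand" "('i, 'a) operand"
  | Sub "('i, 'a) operand" "('i, 'a) operand"
  | Mul "('i, 'a) operand" "('i, 'a) operand"

fun operand_val :: "('i \<Rightarrow> 'a) \<Rightarrow> 'a list \<Rightarrow> ('i, 'a) operand \<Rightarrow> 'a" where
  "operand_val x rs (Input i) = x i"
| "operand_val x rs (Const a) = a"
| "operand_val x rs (Reg k) = rs ! k"

fun instr_val :: "'a ring \<Rightarrow> ('i \<Rightarrow> 'a) \<Rightarrow> 'a list \<Rightarrow> ('i, 'a) instr \<Rightarrow> 'a" where
  "instr_val R x rs (Add a b) = operand_val x rs a \<oplus>\<^bsub>R\<^esub> operand_val x rs b"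
| "instr_val R x rs (Sub a b) = operand_val x rs a \<ominus>\<^bsub>R\<^esub> operand_val x rs b"
| "instr_val R x rs (Mul a b) = operand_val x rs a \<otimes>\<^bsub>R\<^esub> operand_val x rs b"

definition slp_run :: "'a ring \<Rightarrow> ('i \<Rightarrow> 'a) \<Rightarrow> ('i, 'a) instr list \<Rightarrow> 'a list" where
  "slp_run R x P = foldl (\<lambda>rs ins. rs @ [instr_val R x rs ins]) [] P"

text \<open>Well-formedness: only declared inputs, elements of \<open>R\<close>, and earlier registers are used.\<close>

fun operand_ok :: "'a ring \<Rightarrow> 'i set \<Rightarrow> nat \<Rightarrow> ('i, 'a) operand \<Rightarrow> bool" where
  "operand_ok R I k (Input i) \<longleftrightarrow> i \<in> I"
| "operand_ok R I k (Const a) \<longleftrightarrow> a \<in> carrier R"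
| "operand_ok R I k (Reg j) \<longleftrightarrow> j < k"

fun instr_ok :: "'a ring \<Rightarrow> 'i set \<Rightarrow> nat \<Rightarrow> ('i, 'a) instr \<Rightarrow> bool" where
  "instr_ok R I k (Add a b) \<longleftrightarrow> operand_ok R I k a \<and> operand_ok R I k b"
| "instr_ok R I k (Sub a b) \<longleftrightarrow> operand_ok R I k a \<and> operand_ok R I k b"
| "instr_ok R I k (Mul a b) \<longleftrightarrow> operand_ok R I k a \<and> operand_ok R I k b"

text \<open>One program with at most \<open>c\<close> operations that, for every problem instance \<open>x \<in> X\<close>, computes
  the values \<open>out x j\<close>, \<open>j \<in> J\<close>, from the values \<open>inp x i\<close>, \<open>i \<in> I\<close>.\<close>

definition slp_computes ::
    "'a ring \<Rightarrow> 'x set \<Rightarrow> 'i set \<Rightarrow> ('x \<Rightarrow> 'i \<Rightarrow> 'a) \<Rightarrow> 'j set \<Rightarrow> ('x \<Rightarrow> 'j \<Rightarrow> 'a) \<Rightarrow> nat \<Rightarrow> bool" where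
  "slp_computes R X I inp J out c \<longleftrightarrow>
     (\<exists>(P :: ('i, 'a) instr list) res.
        length P \<le> c \<and>
        (\<forall>k<length P. instr_ok R I k (P ! k)) \<and>
        (\<forall>j\<in>J. operand_ok R I (length P) (res j)) \<and>
        (\<forall>x\<in>X. \<forall>j\<in>J. operand_val (inp x) (slp_run R (inp x) P) (res j) = out x j))"

text \<open>\<open>log x\<close> and \<open>log log x\<close>, read as at least 1.\<close>

definition lg :: "real \<Rightarrow> real" where "lg x = max 1 (log 2 x)"

definition llg :: "real \<Rightarrow> real" where "llg x = max 1 (log 2 (lg x))"

definition quasilinear :: "nat \<Rightarrow> real" where
  "quasilinear k = real k * (lg (real k))\<^sup>2 * llg (real k)"

text \<open>The cost model for the extension ring: an operation of \<open>S\<close> carried out on coordinates in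
  \<open>R\<close>, polynomial evaluation and interpolation counted in operations of \<open>S\<close>, and the two maps of
  the RMFE. Points of evaluation are fixed in advance, and interpolation recovers the coefficients
  \<open>a\<close> from the values of the polynomial with coefficients \<open>a\<close>.\<close>

definition arithmetic_cost ::
    "'a ring \<Rightarrow> 'b ring \<Rightarrow> nat \<Rightarrow> ('b \<Rightarrow> nat \<Rightarrow> 'a) \<Rightarrow> real \<Rightarrow> bool" where
  "arithmetic_cost R S m \<kappa> K \<longleftrightarrow>
     (\<forall>f \<in> {\<lambda>x y. x \<oplus>\<^bsub>S\<^esub> y, \<lambda>x y. x \<ominus>\<^bsub>S\<^esub> y, \<lambda>x y. x \<otimes>\<^bsub>S\<^esub> y}. \<exists>c.
        slp_computes R (carrier S \<times> carrier S)
          ((UNIV :: bool set) \<times> {..<m}) (\<lambda>(x, y) (second, l). \<kappa> (if second then y else x) l)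
          {..<m} (\<lambda>(x, y). \<kappa> (f x y)) c \<and>
        real c \<le> K * quasilinear m)"

definition poly_at :: "'b ring \<Rightarrow> nat \<Rightarrow> (nat \<Rightarrow> 'b) \<Rightarrow> 'b \<Rightarrow> 'b" where
  "poly_at S l a x = (\<Oplus>\<^bsub>S\<^esub>k\<in>{..<l}. a k \<otimes>\<^bsub>S\<^esub> x [^]\<^bsub>S\<^esub> k)"

definition polynomial_cost :: "'b ring \<Rightarrow> real \<Rightarrow> bool" where
  "polynomial_cost S K \<longleftrightarrow>
     (\<forall>l \<beta>. 1 \<le> l \<and> inj_on \<beta> {..<l} \<and> exceptional S (\<beta> ` {..<l}) \<longrightarrow>
        (\<exists>c. slp_computes S ({..<l} \<rightarrow>\<^sub>E carrier S)
               {..<l} (\<lambda>a. a) {..<l} (\<lambda>a i. poly_at S l a (\<beta> i)) c \<and>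
             real c \<le> K * quasilinear l) \<and>
        (\<exists>c. slp_computes S ({..<l} \<rightarrow>\<^sub>E carrier S)
               {..<l} (\<lambda>a i. poly_at S l a (\<beta> i)) {..<l} (\<lambda>a. a) c \<and>
             real c \<le> K * quasilinear l))"

definition rmfe_cost ::
    "'a ring \<Rightarrow> 'b ring \<Rightarrow> nat \<Rightarrow> nat \<Rightarrow> ('b \<Rightarrow> nat \<Rightarrow> 'a) \<Rightarrow>
     ((nat \<Rightarrow> 'a) \<Rightarrow> 'b) \<Rightarrow> ('b \<Rightarrow> nat \<Rightarrow> 'a) \<Rightarrow> real \<Rightarrow> bool" where
  "rmfe_cost R S n m \<kappa> \<phi> \<psi> K \<longleftrightarrow>
     (\<exists>c. slp_computes R ({..<n} \<rightarrow>\<^sub>E carrier R)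
            {..<n} (\<lambda>x. x) {..<m} (\<lambda>x. \<kappa> (\<phi> x)) c \<and>
          real c \<le> K * quasilinear m) \<and>
     (\<exists>c. slp_computes R (carrier S)
            {..<m} \<kappa> {..<n} \<psi> c \<and>
          real c \<le> K * quasilinear m)"

section \<open>The scheme\<close>

text \<open>All indices start at 0. A batch is given by \<open>A k i j\<close>, the \<open>(i, j)\<close> entry of the \<open>k\<close>-th
  matrix. Entry \<open>(a, b)\<close> of block \<open>(i, j)\<close> of a \<open>t \<times> r\<close> matrix cut into \<open>u \<times> w\<close> blocks is
  entry \<open>(i * (t div u) + a, j * (r div w) + b)\<close>. With 0-based block indices the exponents
  \<open>(i-1)w + j-1\<close> and \<open>w-k + (l-1)uw\<close> of the EP polynomials become \<open>i*w + j\<close> and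
  \<open>w-1-k + l*u*w\<close>, and block \<open>(i, l)\<close> of the product is the coefficient of \<open>h = f g\<close>
  at \<open>i*w + (w-1) + l*u*w\<close>.\<close>

definition batches ::
    "'a ring \<Rightarrow> nat \<Rightarrow> nat \<Rightarrow> nat \<Rightarrow> nat \<Rightarrow>
     ((nat \<Rightarrow> nat \<Rightarrow> nat \<Rightarrow> 'a) \<times> (nat \<Rightarrow> nat \<Rightarrow> nat \<Rightarrow> 'a)) set" where
  "batches R n t r s = {(A, B).
     (\<forall>k<n. \<forall>i<t. \<forall>j<r. A k i j \<in> carrier R) \<and>
     (\<forall>k<n. \<forall>j<r. \<forall>l<s. B k j l \<in> carrier R)}"

definition batch_product ::
    "'a ring \<Rightarrow> nat \<Rightarrow>
     (nat \<Rightarrow> nat \<Rightarrow> nat \<Rightarrow> 'a) \<times> (nat \<Rightarrow> nat \<Rightarrow> nat \<Rightarrow> 'a) \<Rightarrow> nat \<times> nat \<times> nat \<Rightarrow> 'a" where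
  "batch_product R r = (\<lambda>(A, B) (k, i, l). \<Oplus>\<^bsub>R\<^esub>j\<in>{..<r}. A k i j \<otimes>\<^bsub>R\<^esub> B k j l)"

definition pack ::
    "nat \<Rightarrow> ((nat \<Rightarrow> 'a) \<Rightarrow> 'b) \<Rightarrow> (nat \<Rightarrow> nat \<Rightarrow> nat \<Rightarrow> 'a) \<Rightarrow> nat \<Rightarrow> nat \<Rightarrow> 'b" where
  "pack n \<phi> A i j = \<phi> (\<lambda>k\<in>{..<n}. A k i j)"

definition ep_f ::
    "'b ring \<Rightarrow> nat \<Rightarrow> nat \<Rightarrow> nat \<Rightarrow> nat \<Rightarrow> (nat \<Rightarrow> nat \<Rightarrow> 'b) \<Rightarrow> 'b \<Rightarrow> nat \<Rightarrow> nat \<Rightarrow> 'b" where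
  "ep_f S t r u w M x a b =
     (\<Oplus>\<^bsub>S\<^esub>i\<in>{..<u}. \<Oplus>\<^bsub>S\<^esub>j\<in>{..<w}.
        M (i * (t div u) + a) (j * (r div w) + b) \<otimes>\<^bsub>S\<^esub> x [^]\<^bsub>S\<^esub> (i * w + j))"

definition ep_g ::
    "'b ring \<Rightarrow> nat \<Rightarrow> nat \<Rightarrow> nat \<Rightarrow> nat \<Rightarrow> nat \<Rightarrow> (nat \<Rightarrow> nat \<Rightarrow> 'b) \<Rightarrow> 'b \<Rightarrow> nat \<Rightarrow> nat \<Rightarrow> 'b"
  where
  "ep_g S r s u v w M x b c =
     (\<Oplus>\<^bsub>S\<^esub>k\<in>{..<w}. \<Oplus>\<^bsub>S\<^esub>l\<in>{..<v}.
        M (k * (r div w) + b) (l * (s div v) + c) \<otimes>\<^bsub>S\<^esub> x [^]\<^bsub>S\<^esub> (w - 1 - k + l * u * w))"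

text \<open>The share of worker \<open>i\<close>: \<open>Inl\<close> and \<open>Inr\<close> tag the entries of \<open>f(\<alpha>\<^sub>i)\<close> and of \<open>g(\<alpha>\<^sub>i)\<close>.\<close>

definition encode ::
    "'b ring \<Rightarrow> nat \<Rightarrow> ((nat \<Rightarrow> 'a) \<Rightarrow> 'b) \<Rightarrow> nat \<Rightarrow> nat \<Rightarrow> nat \<Rightarrow> nat \<Rightarrow> nat \<Rightarrow> nat \<Rightarrow> (nat \<Rightarrow> 'b) \<Rightarrow>
     (nat \<Rightarrow> nat \<Rightarrow> nat \<Rightarrow> 'a) \<times> (nat \<Rightarrow> nat \<Rightarrow> nat \<Rightarrow> 'a) \<Rightarrow> nat \<Rightarrow>
     (nat \<times> nat) + (nat \<times> nat) \<Rightarrow> 'b" where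
  "encode S n \<phi> t r s u v w \<alpha> = (\<lambda>(A, B) i.
     case_sum (\<lambda>(a, b). ep_f S t r u w (pack n \<phi> A) (\<alpha> i) a b)
              (\<lambda>(b, c). ep_g S r s u v w (pack n \<phi> B) (\<alpha> i) b c))"

definition worker ::
    "'b ring \<Rightarrow> nat \<Rightarrow> nat \<Rightarrow> ((nat \<times> nat) + (nat \<times> nat) \<Rightarrow> 'b) \<Rightarrow> nat \<times> nat \<Rightarrow> 'b" where
  "worker S r w sh = (\<lambda>(a, c). \<Oplus>\<^bsub>S\<^esub>b\<in>{..<r div w}. sh (Inl (a, b)) \<otimes>\<^bsub>S\<^esub> sh (Inr (b, c)))"

definition response ::
    "'b ring \<Rightarrow> nat \<Rightarrow> ((nat \<Rightarrow> 'a) \<Rightarrow> 'b) \<Rightarrow> nat \<Rightarrow> nat \<Rightarrow> nat \<Rightarrow> nat \<Rightarrow> nat \<Rightarrow> nat \<Rightarrow> (nat \<Rightarrow> 'b) \<Rightarrow>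
     (nat \<Rightarrow> nat \<Rightarrow> nat \<Rightarrow> 'a) \<times> (nat \<Rightarrow> nat \<Rightarrow> nat \<Rightarrow> 'a) \<Rightarrow> nat \<Rightarrow> nat \<times> nat \<Rightarrow> 'b" where
  "response S n \<phi> t r s u v w \<alpha> x i = worker S r w (encode S n \<phi> t r s u v w \<alpha> x i)"

text \<open>The coefficients of the polynomial of degree less than \<open>R\<close> with value \<open>y i\<close> at \<open>\<alpha> i\<close>, \<open>i \<in> W\<close>.\<close>

definition interpolant ::
    "'b ring \<Rightarrow> nat \<Rightarrow> (nat \<Rightarrow> 'b) \<Rightarrow> nat set \<Rightarrow> (nat \<Rightarrow> 'b) \<Rightarrow> nat \<Rightarrow> 'b" where
  "interpolant S R \<alpha> W y =
     (THE h. h \<in> {..<R} \<rightarrow>\<^sub>E carrier S \<and> (\<forall>i\<in>W. poly_at S R h (\<alpha> i) = y i))"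

definition ep_decode ::
    "'b ring \<Rightarrow> nat \<Rightarrow> nat \<Rightarrow> nat \<Rightarrow> nat \<Rightarrow> nat \<Rightarrow> (nat \<Rightarrow> 'b) \<Rightarrow>
     nat set \<Rightarrow> (nat \<Rightarrow> nat \<times> nat \<Rightarrow> 'b) \<Rightarrow> nat \<Rightarrow> nat \<Rightarrow> 'b" where
  "ep_decode S t s u v w \<alpha> W Y x z =
     (let i = x div (t div u); a = x mod (t div u);
          l = z div (s div v); c = z mod (s div v)
      in interpolant S (u * v * w + w - 1) \<alpha> W (\<lambda>q. Y q (a, c)) (i * w + (w - 1) + l * u * w))"

definition decode ::
    "'b ring \<Rightarrow> ('b \<Rightarrow> nat \<Rightarrow> 'a) \<Rightarrow> nat \<Rightarrow> nat \<Rightarrow> nat \<Rightarrow> nat \<Rightarrow> nat \<Rightarrow> (nat \<Rightarrow> 'b) \<Rightarrow>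
     nat set \<Rightarrow> (nat \<Rightarrow> nat \<times> nat \<Rightarrow> 'b) \<Rightarrow> nat \<times> nat \<times> nat \<Rightarrow> 'a" where
  "decode S \<psi> t s u v w \<alpha> W Y = (\<lambda>(k, i, l). \<psi> (ep_decode S t s u v w \<alpha> W Y i l) k)"

definition recovery_threshold ::
    "nat \<Rightarrow> nat \<Rightarrow> 'x set \<Rightarrow> ('x \<Rightarrow> nat \<Rightarrow> 'y) \<Rightarrow> (nat set \<Rightarrow> (nat \<Rightarrow> 'y) \<Rightarrow> 'j \<Rightarrow> 'a) \<Rightarrow>
     'j set \<Rightarrow> ('x \<Rightarrow> 'j \<Rightarrow> 'a) \<Rightarrow> bool" where
  "recovery_threshold N R X resp dec J target \<longleftrightarrow>
     (\<forall>W. W \<subseteq> {..<N} \<and> card W = R \<longrightarrow>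
        (\<forall>x\<in>X. \<forall>j\<in>J. dec W (restrict (resp x) W) j = target x j))"

section \<open>Data held and transmitted\<close>

definition batch_index ::
    "nat \<Rightarrow> nat \<Rightarrow> nat \<Rightarrow> nat \<Rightarrow> ((nat \<times> nat \<times> nat) + (nat \<times> nat \<times> nat)) set" where
  "batch_index n t r s =
     ({..<n} \<times> {..<t} \<times> {..<r}) <+> ({..<n} \<times> {..<r} \<times> {..<s})"

definition batch_entry ::
    "(nat \<Rightarrow> nat \<Rightarrow> nat \<Rightarrow> 'a) \<times> (nat \<Rightarrow> nat \<Rightarrow> nat \<Rightarrow> 'a) \<Rightarrow>
     (nat \<times> nat \<times> nat) + (nat \<times> nat \<times> nat) \<Rightarrow> 'a" where
  "batch_entry = (\<lambda>(A, B). case_sum (\<lambda>(k, i, j). A k i j) (\<lambda>(k, i, j). B k i j))"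

definition share_index ::
    "nat \<Rightarrow> nat \<Rightarrow> nat \<Rightarrow> nat \<Rightarrow> nat \<Rightarrow> nat \<Rightarrow> ((nat \<times> nat) + (nat \<times> nat)) set" where
  "share_index t r s u v w =
     ({..<t div u} \<times> {..<r div w}) <+> ({..<r div w} \<times> {..<s div v})"

definition response_index :: "nat \<Rightarrow> nat \<Rightarrow> nat \<Rightarrow> nat \<Rightarrow> (nat \<times> nat) set" where
  "response_index t s u v = {..<t div u} \<times> {..<s div v}"

text \<open>The elements of the base ring sent to the workers, and received from the workers in \<open>W\<close>:
  triples of a worker, a matrix entry, and a coordinate of that entry.\<close>

definition upload_index ::
    "nat \<Rightarrow> nat \<Rightarrow> nat \<Rightarrow> nat \<Rightarrow> nat \<Rightarrow> nat \<Rightarrow> nat \<Rightarrow> nat \<Rightarrow>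
     (nat \<times> ((nat \<times> nat) + (nat \<times> nat)) \<times> nat) set" where
  "upload_index N m t r s u v w = {..<N} \<times> share_index t r s u v w \<times> {..<m}"

definition download_index ::
    "nat set \<Rightarrow> nat \<Rightarrow> nat \<Rightarrow> nat \<Rightarrow> nat \<Rightarrow> nat \<Rightarrow> (nat \<times> (nat \<times> nat) \<times> nat) set" where
  "download_index W m t s u v = W \<times> response_index t s u v \<times> {..<m}"

definition encoding_cost ::
    "'a ring \<Rightarrow> 'b ring \<Rightarrow> ('b \<Rightarrow> nat \<Rightarrow> 'a) \<Rightarrow> nat \<Rightarrow> nat \<Rightarrow> nat \<Rightarrow> ((nat \<Rightarrow> 'a) \<Rightarrow> 'b) \<Rightarrow>
     nat \<Rightarrow> nat \<Rightarrow> nat \<Rightarrow> nat \<Rightarrow> nat \<Rightarrow> nat \<Rightarrow> (nat \<Rightarrow> 'b) \<Rightarrow> nat \<Rightarrow> bool" where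
  "encoding_cost R S \<kappa> N m n \<phi> t r s u v w \<alpha> c \<longleftrightarrow>
     slp_computes R (batches R n t r s)
       (batch_index n t r s) batch_entry
       (upload_index N m t r s u v w)
       (\<lambda>x (i, q, l). \<kappa> (encode S n \<phi> t r s u v w \<alpha> x i q) l) c"

definition worker_cost ::
    "'a ring \<Rightarrow> 'b ring \<Rightarrow> ('b \<Rightarrow> nat \<Rightarrow> 'a) \<Rightarrow> nat \<Rightarrow>
     nat \<Rightarrow> nat \<Rightarrow> nat \<Rightarrow> nat \<Rightarrow> nat \<Rightarrow> nat \<Rightarrow> nat \<Rightarrow> bool" where
  "worker_cost R S \<kappa> m t r s u v w c \<longleftrightarrow>
     slp_computes R (share_index t r s u v w \<rightarrow> carrier S)
       (share_index t r s u v w \<times> {..<m}) (\<lambda>sh (q, l). \<kappa> (sh q) l)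
       (response_index t s u v \<times> {..<m}) (\<lambda>sh (q, l). \<kappa> (worker S r w sh q) l) c"

text \<open>The decoding program may depend on the set \<open>W\<close> of responding workers, as the interpolation
  points do.\<close>

definition decoding_cost ::
    "'a ring \<Rightarrow> 'b ring \<Rightarrow> ('b \<Rightarrow> nat \<Rightarrow> 'a) \<Rightarrow> nat \<Rightarrow> nat \<Rightarrow>
     ((nat \<Rightarrow> 'a) \<Rightarrow> 'b) \<Rightarrow> ('b \<Rightarrow> nat \<Rightarrow> 'a) \<Rightarrow>
     nat \<Rightarrow> nat \<Rightarrow> nat \<Rightarrow> nat \<Rightarrow> nat \<Rightarrow> nat \<Rightarrow> (nat \<Rightarrow> 'b) \<Rightarrow> nat set \<Rightarrow> nat \<Rightarrow> bool" where
  "decoding_cost R S \<kappa> m n \<phi> \<psi> t r s u v w \<alpha> W c \<longleftrightarrow>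
     slp_computes R (batches R n t r s)
       (download_index W m t s u v)
       (\<lambda>x (i, q, l). \<kappa> (response S n \<phi> t r s u v w \<alpha> x i q) l)
       ({..<n} \<times> {..<t} \<times> {..<s})
       (\<lambda>x. decode S \<psi> t s u v w \<alpha> W (restrict (response S n \<phi> t r s u v w \<alpha> x) W)) c"

end

theory Submission
  imports Defs
begin

text \<open>The response of worker \<open>i\<close> is the value at \<open>\<alpha>\<^sub>i\<close> of \<open>h = f g\<close>, whose degree is less than
  \<open>R = uvw + w - 1\<close>. Differences of exceptional points are units, so a polynomial of degree less than
  \<open>R\<close> that vanishes at \<open>R\<close> of them is zero, and any \<open>R\<close> responses determine \<open>h\<close>. The exponents are
  chosen such that the coefficient of \<open>h\<close> at \<open>iw + (w-1) + luw\<close> only collects the products with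
  \<open>j = k\<close>, which form block \<open>(i, l)\<close> of the packed product, and \<open>\<psi>\<close> is additive, so it unpacks
  sums of products of packed entries.

  For the costs, programs over the extension are turned into programs over the base ring
  operation by operation. As \<open>m\<close> is at most \<open>2 log N\<close>, an operation on \<open>m\<close> coordinates costs
  \<open>m (log log N)\<^sup>3\<close> up to a constant. Division by \<open>n\<close> absorbs the factor \<open>m\<close>, and a further factor
  \<open>log log N\<close> comes from fast evaluation and interpolation, whence \<open>k = 4\<close>.\<close>

section \<open>Composition of straight-line programs\<close>

text \<open>Packing and unpacking touch every entry of the matrices, whereas the bounds count
  entries of blocks, times \<open>N\<close> or \<open>R\<close>. The two are reconciled by
  \<open>u * w\<close> and \<open>w * v\<close> being at most \<open>N\<close> and
  \<open>u * v\<close> being at most \<open>R\<close>: the calls of \<open>\<phi>\<close> (one per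
  entry of the packed factors) and of \<open>\<psi>\<close> (one per entry of the product) do not
  outnumber the polynomials evaluated or interpolated, times their length.

  A program has to be right only on a given set of instances. So an interpolation program can be fed
  with responses, which are known to be values of a polynomial of length \<open>R\<close>; nothing
  is claimed about other data. Outputs of a program may be any operands, also inputs or constants.
  Hence passing between indexings (entries, blocks, coefficients, workers) and padding polynomials
  with zeros cost nothing, and only arithmetic is counted.

  The constants \<open>K_arith\<close>, \<open>K_poly\<close>, \<open>K_rmfe\<close> have no
  prescribed sign, which is why absolute values appear.\<close>

lemma slp_run_Nil [simp]: "slp_run R x [] = []"
  by (simp add: slp_run_def)

lemma slp_run_snoc:
  "slp_run R x (P @ [a]) = slp_run R x P @ [instr_val R x (slp_run R x P) a]"
  by (simp add: slp_run_def)

lemma length_slp_run [simp]: "length (slp_run R x P) = length P"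
  by (induction P rule: rev_induct) (simp_all add: slp_run_snoc)

text \<open>Prepares a program to run behind \<open>n\<close> instructions of another one: its
  registers move up by \<open>n\<close>, and each of its inputs becomes an operand supplied by the
  wiring \<open>\<sigma>\<close>.\<close>

fun subst_operand ::
    "nat \<Rightarrow> ('j \<Rightarrow> ('i, 'a) operand) \<Rightarrow> ('j, 'a) operand \<Rightarrow> ('i, 'a) operand" where
  "subst_operand n \<sigma> (Input j) = \<sigma> j"
| "subst_operand n \<sigma> (Const a) = Const a"
| "subst_operand n \<sigma> (Reg k) = Reg (n + k)"

fun subst_instr ::
    "nat \<Rightarrow> ('j \<Rightarrow> ('i, 'a) operand) \<Rightarrow> ('j, 'a) instr \<Rightarrow> ('i, 'a) instr" where
  "subst_instr n \<sigma> (Add a b) = Add (subst_operand n \<sigma> a) (subst_operand n \<sigma> b)"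
| "subst_instr n \<sigma> (Sub a b) = Sub (subst_operand n \<sigma> a) (subst_operand n \<sigma> b)"
| "subst_instr n \<sigma> (Mul a b) = Mul (subst_operand n \<sigma> a) (subst_operand n \<sigma> b)"

lemma instrs_ok_snoc:
  "(\<forall>k<length (P @ [a]). instr_ok R I k ((P @ [a]) ! k)) \<longleftrightarrow>
     (\<forall>k<length P. instr_ok R I k (P ! k)) \<and> instr_ok R I (length P) a"
  by (auto simp: nth_append less_Suc_eq)

lemma operand_val_append:
  "operand_ok R I (length rs) a \<Longrightarrow> operand_val x (rs @ rs') a = operand_val x rs a"
  by (cases a) (simp_all add: nth_append)

lemma operand_ok_mono: "operand_ok R I k a \<Longrightarrow> k \<le> k' \<Longrightarrow> operand_ok R I k' a"
  by (cases a) simp_all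

lemma operand_ok_subst:
  assumes "\<forall>j\<in>J. operand_ok R I n (\<sigma> j)" and "operand_ok R J k a"
  shows "operand_ok R I (n + k) (subst_operand n \<sigma> a)"
proof (cases a)
  case (Input j)
  then show ?thesis using assms operand_ok_mono[of R I n "\<sigma> j" "n + k"] by simp
qed (use assms(2) in simp_all)

lemma instr_ok_subst:
  assumes "\<forall>j\<in>J. operand_ok R I n (\<sigma> j)" and "instr_ok R J k a"
  shows "instr_ok R I (n + k) (subst_instr n \<sigma> a)"
  using assms(2) operand_ok_subst[OF assms(1), of k] by (cases a) simp_all

lemma operand_val_subst:
  assumes "\<forall>j\<in>J. operand_ok R I (length rs) (\<sigma> j)"
    and "\<forall>j\<in>J. operand_val x rs (\<sigma> j) = y j"
    and "operand_ok R J k a"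
  shows "operand_val x (rs @ rs') (subst_operand (length rs) \<sigma> a) = operand_val y rs' a"
proof (cases a)
  case (Input j)
  then show ?thesis using assms operand_val_append[of R I rs "\<sigma> j" x rs'] by simp
qed (simp_all add: nth_append)

lemma instr_val_subst:
  assumes "\<forall>j\<in>J. operand_ok R I (length rs) (\<sigma> j)"
    and "\<forall>j\<in>J. operand_val x rs (\<sigma> j) = y j"
    and "instr_ok R J k a"
  shows "instr_val R x (rs @ rs') (subst_instr (length rs) \<sigma> a) = instr_val R y rs' a"
  using assms(3) operand_val_subst[OF assms(1,2), of k _ rs'] by (cases a) simp_all

text \<open>The wiring refers to registers of \<open>P\<close> only, and these keep their values
  while \<open>Q\<close> appends its own. So the second half of the run is a run of \<open>Q\<close>
  on the values \<open>y\<close> delivered by the wiring.\<close>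

lemma slp_run_subst:
  assumes "\<forall>j\<in>J. operand_ok R I (length P) (\<sigma> j)"
    and "\<forall>j\<in>J. operand_val x (slp_run R x P) (\<sigma> j) = y j"
    and "\<forall>k<length Q. instr_ok R J k (Q ! k)"
  shows "slp_run R x (P @ map (subst_instr (length P) \<sigma>) Q) = slp_run R x P @ slp_run R y Q"
  using assms(3)
proof (induction Q rule: rev_induct)
  case (snoc a Q)
  have ok: "\<forall>k<length Q. instr_ok R J k (Q ! k)" "instr_ok R J (length Q) a"
    using snoc.prems unfolding instrs_ok_snoc by simp_all
  have "instr_val R x (slp_run R x P @ slp_run R y Q) (subst_instr (length P) \<sigma> a)
      = instr_val R y (slp_run R y Q) a"
    using instr_val_subst[of J R I "slp_run R x P" \<sigma> x y, OF _ _ ok(2)] assms(1,2) by simp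
  then show ?case
    using snoc.IH[OF ok(1)] slp_run_snoc[of R x "P @ map (subst_instr (length P) \<sigma>) Q"]
    by (simp add: slp_run_snoc)
qed simp

section \<open>Sequential and parallel composition\<close>

lemma instrs_ok_append:
  assumes "\<forall>k<length P. instr_ok R I k (P ! k)" and "\<forall>k<length Q. instr_ok R I (length P + k) (Q ! k)"
  shows "\<forall>k<length (P @ Q). instr_ok R I k ((P @ Q) ! k)"
proof (intro allI impI)
  fix k assume "k < length (P @ Q)"
  then show "instr_ok R I k ((P @ Q) ! k)"
    using assms(1) assms(2)[rule_format, of "k - length P"]
    by (cases "k < length P") (simp_all add: nth_append)
qed

lemma slp_computesE:
  assumes "slp_computes R X I inp J out c"
  obtains P \<sigma> where "length P \<le> c" "\<forall>k<length P. instr_ok R I k (P ! k)"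
    "\<forall>j\<in>J. operand_ok R I (length P) (\<sigma> j)"
    "\<forall>x\<in>X. \<forall>j\<in>J. operand_val (inp x) (slp_run R (inp x) P) (\<sigma> j) = out x j"
  using assms unfolding slp_computes_def by auto

lemma slp_computesI:
  assumes "length P \<le> c" "\<forall>k<length P. instr_ok R I k (P ! k)"
    "\<And>j. j \<in> J \<Longrightarrow> operand_ok R I (length P) (\<sigma> j)"
    "\<And>x j. x \<in> X \<Longrightarrow> j \<in> J \<Longrightarrow> operand_val (inp x) (slp_run R (inp x) P) (\<sigma> j) = out x j"
  shows "slp_computes R X I inp J out c"
  unfolding slp_computes_def using assms by (intro exI[of _ P] exI[of _ \<sigma>]) blast

text \<open>The output operands of the first program serve directly as the wiring for the inputs of
  the second, so the costs add up with no charge for copying.\<close>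

lemma slp_computes_compose:
  assumes "slp_computes R X I inp J mid c" and "slp_computes R X J mid L out c'"
  shows "slp_computes R X I inp L out (c + c')"
proof -
  obtain P \<sigma> where P: "length P \<le> c" "\<forall>k<length P. instr_ok R I k (P ! k)"
      "\<forall>j\<in>J. operand_ok R I (length P) (\<sigma> j)"
      "\<forall>x\<in>X. \<forall>j\<in>J. operand_val (inp x) (slp_run R (inp x) P) (\<sigma> j) = mid x j"
    using assms(1) by (rule slp_computesE)
  obtain Q \<tau> where Q: "length Q \<le> c'" "\<forall>k<length Q. instr_ok R J k (Q ! k)"
      "\<forall>j\<in>L. operand_ok R J (length Q) (\<tau> j)"
      "\<forall>x\<in>X. \<forall>j\<in>L. operand_val (mid x) (slp_run R (mid x) Q) (\<tau> j) = out x j"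
    using assms(2) by (rule slp_computesE)
  let ?Q = "map (subst_instr (length P) \<sigma>) Q"
  show ?thesis
  proof (rule slp_computesI)
    show "length (P @ ?Q) \<le> c + c'"
      using P(1) Q(1) by simp
    show "\<forall>k<length (P @ ?Q). instr_ok R I k ((P @ ?Q) ! k)"
      using P(2) Q(2) instr_ok_subst[OF P(3)] by (intro instrs_ok_append) simp_all
    fix j assume j: "j \<in> L"
    show "operand_ok R I (length (P @ ?Q)) (subst_operand (length P) \<sigma> (\<tau> j))"
      using operand_ok_subst[OF P(3)] Q(3) j by simp
    fix x assume x: "x \<in> X"
    have "operand_val (inp x) (slp_run R (inp x) P @ slp_run R (mid x) Q)
        (subst_operand (length (slp_run R (inp x) P)) \<sigma> (\<tau> j))
      = operand_val (mid x) (slp_run R (mid x) Q) (\<tau> j)"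
      using P(3,4) Q(3) x j by (intro operand_val_subst[of J R I _ _ _ _ "length Q"]) simp_all
    then show "operand_val (inp x) (slp_run R (inp x) (P @ ?Q))
        (subst_operand (length P) \<sigma> (\<tau> j)) = out x j"
      using slp_run_subst[OF P(3) _ Q(2), of "inp x" "mid x"] P(4) Q(4) x j by simp
  qed
qed

text \<open>Composition with the identity wiring \<open>Input\<close>: the second program still
  reads the original inputs, only its registers are shifted. The tagged sum keeps the two output
  index types apart.\<close>

lemma slp_computes_par:
  assumes "slp_computes R X I inp J out c" and "slp_computes R X I inp J' out' c'"
  shows "slp_computes R X I inp (Sum_Type.Plus J J') (\<lambda>x. case_sum (out x) (out' x)) (c + c')"
proof -
  obtain P \<sigma> where P: "length P \<le> c" "\<forall>k<length P. instr_ok R I k (P ! k)"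
      "\<forall>j\<in>J. operand_ok R I (length P) (\<sigma> j)"
      "\<forall>x\<in>X. \<forall>j\<in>J. operand_val (inp x) (slp_run R (inp x) P) (\<sigma> j) = out x j"
    using assms(1) by (rule slp_computesE)
  obtain Q \<tau> where Q: "length Q \<le> c'" "\<forall>k<length Q. instr_ok R I k (Q ! k)"
      "\<forall>j\<in>J'. operand_ok R I (length Q) (\<tau> j)"
      "\<forall>x\<in>X. \<forall>j\<in>J'. operand_val (inp x) (slp_run R (inp x) Q) (\<tau> j) = out' x j"
    using assms(2) by (rule slp_computesE)
  let ?Q = "map (subst_instr (length P) Input) Q"
  let ?\<rho> = "case_sum \<sigma> (\<lambda>j. subst_operand (length P) Input (\<tau> j))"
  have input: "\<forall>i\<in>I. operand_ok R I (length P) (Input i)"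
    by simp
  show ?thesis
  proof (rule slp_computesI)
    show "length (P @ ?Q) \<le> c + c'"
      using P(1) Q(1) by simp
    show "\<forall>k<length (P @ ?Q). instr_ok R I k ((P @ ?Q) ! k)"
      using P(2) Q(2) instr_ok_subst[OF input] by (intro instrs_ok_append) simp_all
    fix j assume j: "j \<in> Sum_Type.Plus J J'"
    then show "operand_ok R I (length (P @ ?Q)) (?\<rho> j)"
      using operand_ok_subst[OF input] operand_ok_mono[of R I "length P" _ "length P + length Q"]
        P(3) Q(3) by (elim PlusE) simp_all
    fix x assume x: "x \<in> X"
    have run: "slp_run R (inp x) (P @ ?Q) = slp_run R (inp x) P @ slp_run R (inp x) Q"
      using slp_run_subst[OF input _ Q(2)] by simp
    have val: "operand_val (inp x) (slp_run R (inp x) P @ slp_run R (inp x) Q)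
        (subst_operand (length (slp_run R (inp x) P)) Input (\<tau> j'))
      = operand_val (inp x) (slp_run R (inp x) Q) (\<tau> j')" if "j' \<in> J'" for j'
      using Q(3) that by (intro operand_val_subst[of I R I _ _ _ _ "length Q"]) simp_all
    show "operand_val (inp x) (slp_run R (inp x) (P @ ?Q)) (?\<rho> j) = case_sum (out x) (out' x) j"
      using j
    proof (rule PlusE)
      fix i assume "i \<in> J" "j = Inl i"
      then show ?thesis
        using run P(3,4) x operand_val_append[of R I "slp_run R (inp x) P" "\<sigma> i"] by simp
    next
      fix i assume "i \<in> J'" "j = Inr i"
      then show ?thesis
        using run Q(4) x val[of i] by simp
    qed
  qed
qed

text \<open>A value that some operand denotes without any computation.\<close>

definition available :: "'a ring \<Rightarrow> 'x set \<Rightarrow> 'i set \<Rightarrow> ('x \<Rightarrow> 'i \<Rightarrow> 'a) \<Rightarrow> ('x \<Rightarrow> 'a) \<Rightarrow> bool" where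
  "available R X I inp h \<longleftrightarrow>
     (\<exists>i\<in>I. \<forall>x\<in>X. h x = inp x i) \<or> (\<exists>a\<in>carrier R. \<forall>x\<in>X. h x = a)"

lemma available_input: "i \<in> I \<Longrightarrow> (\<And>x. x \<in> X \<Longrightarrow> h x = inp x i) \<Longrightarrow> available R X I inp h"
  unfolding available_def by blast

lemma available_self [intro]: "i \<in> I \<Longrightarrow> available R X I inp (\<lambda>x. inp x i)"
  by (rule available_input) simp_all

lemma available_const:
  "a \<in> carrier R \<Longrightarrow> (\<And>x. x \<in> X \<Longrightarrow> h x = a) \<Longrightarrow> available R X I inp h"
  unfolding available_def by blast

text \<open>The empty program suffices, with the operands chosen per output. This is what makes
  renaming, duplicating or dropping values and inserting constants free.\<close>

lemma slp_computes_wire: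
  assumes "\<And>j. j \<in> J \<Longrightarrow> available R X I inp (\<lambda>x. out x j)"
  shows "slp_computes R X I inp J out 0"
proof -
  have "\<exists>a. operand_ok R I 0 a \<and> (\<forall>x\<in>X. operand_val (inp x) [] a = out x j)" if "j \<in> J" for j
    using assms[OF that] unfolding available_def
  proof (elim disjE bexE)
    fix i assume "i \<in> I" "\<forall>x\<in>X. out x j = inp x i"
    then show ?thesis by (intro exI[of _ "Input i"]) simp
  next
    fix a assume "a \<in> carrier R" "\<forall>x\<in>X. out x j = a"
    then show ?thesis by (intro exI[of _ "Const a"]) simp
  qed
  then have "\<exists>\<rho>. \<forall>j\<in>J. operand_ok R I 0 (\<rho> j) \<and> (\<forall>x\<in>X. operand_val (inp x) [] (\<rho> j) = out x j)"
    by (intro bchoice) blast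
  then obtain \<rho> where
    "\<forall>j\<in>J. operand_ok R I 0 (\<rho> j) \<and> (\<forall>x\<in>X. operand_val (inp x) [] (\<rho> j) = out x j)"
    by (rule exE)
  then show ?thesis
    by (intro slp_computesI[of "[]" 0 R I J \<rho>]) simp_all
qed

lemma slp_computes_refl: "slp_computes R X I inp I inp 0"
  by (rule slp_computes_wire) (rule available_self)

lemma slp_computes_pullback:
  assumes "slp_computes R X' I inp J out c" and "g \<in> X \<rightarrow> X'"
  shows "slp_computes R X I (\<lambda>x. inp (g x)) J (\<lambda>x. out (g x)) c"
proof -
  have "g x \<in> X'" if "x \<in> X" for x
    using assms(2) that by auto
  moreover obtain P \<sigma> where "length P \<le> c" "\<forall>k<length P. instr_ok R I k (P ! k)"
      "\<forall>j\<in>J. operand_ok R I (length P) (\<sigma> j)"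
      "\<forall>x\<in>X'. \<forall>j\<in>J. operand_val (inp x) (slp_run R (inp x) P) (\<sigma> j) = out x j"
    using assms(1) by (rule slp_computesE)
  ultimately show ?thesis
    by (intro slp_computesI[of P c R I J \<sigma>]) simp_all
qed

lemma slp_computes_mono:
  assumes "slp_computes R X I inp J out c" and "c \<le> c'"
  shows "slp_computes R X I inp J out c'"
proof -
  obtain P \<sigma> where "length P \<le> c" "\<forall>k<length P. instr_ok R I k (P ! k)"
      "\<forall>j\<in>J. operand_ok R I (length P) (\<sigma> j)"
      "\<forall>x\<in>X. \<forall>j\<in>J. operand_val (inp x) (slp_run R (inp x) P) (\<sigma> j) = out x j"
    using assms(1) by (rule slp_computesE)
  with assms(2) show ?thesis
    by (intro slp_computesI[of P c' R I J \<sigma>]) simp_all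
qed

text \<open>Lets a generic program (one operation of the extension, an evaluation, an interpolation,
  a map of the RMFE) act inside the scheme: \<open>g\<close> turns an instance of the scheme into an
  instance of the generic problem, and inputs and outputs are rewired at no cost.\<close>

lemma slp_computes_adapt:
  assumes "slp_computes R X' I' inp' J' out' c" and "g \<in> X \<rightarrow> X'"
    and "\<And>i. i \<in> I' \<Longrightarrow> available R X I inp (\<lambda>x. inp' (g x) i)"
    and "\<And>j. j \<in> J \<Longrightarrow> available R X J' (\<lambda>x. out' (g x)) (\<lambda>x. out x j)"
  shows "slp_computes R X I inp J out c"
proof -
  have "slp_computes R X I inp I' (\<lambda>x. inp' (g x)) 0"
    using assms(3) by (rule slp_computes_wire)
  from slp_computes_compose[OF this slp_computes_pullback[OF assms(1,2)]]
  have "slp_computes R X I inp J' (\<lambda>x. out' (g x)) c"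
    by simp
  moreover have "slp_computes R X J' (\<lambda>x. out' (g x)) J out 0"
    using assms(4) by (rule slp_computes_wire)
  ultimately have "slp_computes R X I inp J out (c + 0)"
    by (rule slp_computes_compose)
  then show ?thesis
    by simp
qed

lemma slp_computes_relabel:
  assumes "slp_computes R X I inp J' out' c"
    and "\<And>j. j \<in> J \<Longrightarrow> available R X J' out' (\<lambda>x. out x j)"
  shows "slp_computes R X I inp J out c"
proof -
  have "slp_computes R X J' out' J out 0"
    using assms(2) by (rule slp_computes_wire)
  from slp_computes_compose[OF assms(1) this] show ?thesis
    by simp
qed

text \<open>Nothing is shared between the members; all programs read the same inputs and are placed
  side by side.\<close>

lemma slp_computes_family:
  assumes "finite Q" and "\<And>q. q \<in> Q \<Longrightarrow> slp_computes R X I inp J (out q) c"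
  shows "slp_computes R X I inp (Q \<times> J) (\<lambda>x (q, j). out q x j) (card Q * c)"
  using assms
proof (induction Q)
  case empty
  have "slp_computes R X I inp ({} \<times> J) (\<lambda>x (q, j). out q x j) 0"
    by (rule slp_computes_wire) simp
  then show ?case by simp
next
  case (insert q Q)
  have "slp_computes R X I inp (Sum_Type.Plus J (Q \<times> J))
      (\<lambda>x. case_sum (out q x) (\<lambda>(q, j). out q x j)) (c + card Q * c)"
    using insert by (intro slp_computes_par) simp_all
  then have "slp_computes R X I inp (insert q Q \<times> J) (\<lambda>x (q, j). out q x j) (c + card Q * c)"
  proof (rule slp_computes_relabel)
    fix i assume "i \<in> insert q Q \<times> J"
    then consider j where "i = (q, j)" "j \<in> J" | q' j where "i = (q', j)" "q' \<in> Q" "j \<in> J"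
      by auto
    then show "available R X (Sum_Type.Plus J (Q \<times> J))
        (\<lambda>x. case_sum (out q x) (\<lambda>(q, j). out q x j)) (\<lambda>x. case i of (q, j) \<Rightarrow> out q x j)"
    proof cases
      case (1 j)
      then show ?thesis by (intro available_input[of "Inl j"]) auto
    next
      case (2 q' j)
      then show ?thesis by (intro available_input[of "Inr (q', j)"]) auto
    qed
  qed
  then show ?case
    using insert.hyps by simp
qed

section \<open>Transfer from an extension ring to coordinates\<close>

lemma operand_val_closed:
  assumes "operand_ok S I (length rs) a" and "\<And>i. i \<in> I \<Longrightarrow> x i \<in> carrier S"
    and "set rs \<subseteq> carrier S"
  shows "operand_val x rs a \<in> carrier S"
  using assms nth_mem[of _ rs] by (cases a) (simp_all add: subset_iff)

lemma slp_run_closed: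
  assumes "ring S" and "\<And>i. i \<in> I \<Longrightarrow> x i \<in> carrier S"
    and "\<forall>k<length P. instr_ok S I k (P ! k)"
  shows "set (slp_run S x P) \<subseteq> carrier S"
  using assms(3)
proof (induction P rule: rev_induct)
  case (snoc a P)
  interpret ring S by fact
  have ok: "\<forall>k<length P. instr_ok S I k (P ! k)" "instr_ok S I (length P) a"
    using snoc.prems unfolding instrs_ok_snoc by simp_all
  note closed = operand_val_closed[of S I "slp_run S x P", OF _ assms(2) snoc.IH[OF ok(1)]]
  have "instr_val S x (slp_run S x P) a \<in> carrier S"
    using ok(2) closed by (cases a) simp_all
  then show ?case
    using snoc.IH[OF ok(1)] by (simp add: slp_run_snoc)
qed simp

text \<open>Every instruction over \<open>S\<close> is replaced by a program on coordinates with
  \<open>c0\<close> operations. The induction over the program carries a \<open>state\<close> with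
  the coordinates of all inputs (left tag) and of all registers so far (right tag), since the next
  instruction may refer to any of them.\<close>

lemma slp_computes_lift:
  fixes R :: "'a ring" and S :: "'b ring" and M :: "'l set" and inp :: "'x \<Rightarrow> 'i \<Rightarrow> 'b"
  assumes "ring S" and \<kappa>: "\<And>a l. a \<in> carrier S \<Longrightarrow> l \<in> M \<Longrightarrow> \<kappa> a l \<in> carrier R"
    and ops: "\<And>h. h \<in> {add S, \<lambda>x y. x \<ominus>\<^bsub>S\<^esub> y, mult S} \<Longrightarrow>
      slp_computes R (carrier S \<times> carrier S) ((UNIV :: bool set) \<times> M)
        (\<lambda>(x, y) (second, l). \<kappa> (if second then y else x) l) M (\<lambda>(x, y). \<kappa> (h x y)) c0"
    and S: "slp_computes S X I inp J out c"
    and inp: "\<And>x i. x \<in> X \<Longrightarrow> i \<in> I \<Longrightarrow> inp x i \<in> carrier S"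
  shows "slp_computes R X (I \<times> M) (\<lambda>x (i, l). \<kappa> (inp x i) l) (J \<times> M)
    (\<lambda>x (j, l). \<kappa> (out x j) l) (c * c0)"
proof -
  define inp' where "inp' = (\<lambda>x (i, l). \<kappa> (inp x i) l)"
  define regs where "regs P = (\<lambda>x (k, l). \<kappa> (slp_run S (inp x) P ! k) l)" for P
  define state where "state P = Sum_Type.Plus (I \<times> M) ({..<length P} \<times> M)" for P :: "('i, 'b) instr list"
  define stv where "stv P = (\<lambda>x. case_sum (inp' x) (regs P x))" for P
  define opv where "opv P a x = operand_val (inp x) (slp_run S (inp x) P) a" for P a x
  have avail: "available R X (state P) (stv P) (\<lambda>x. \<kappa> (opv P a x) l)"
    if "operand_ok S I (length P) a" "l \<in> M" for P a l
  proof (cases a)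
    case (Input i)
    with that show ?thesis
      by (intro available_input[of "Inl (i, l)"]) (auto simp: state_def stv_def opv_def inp'_def)
  next
    case (Const b)
    with that show ?thesis
      by (intro available_const[of "\<kappa> b l"]) (auto simp: opv_def \<kappa>)
  next
    case (Reg k)
    with that show ?thesis
      by (intro available_input[of "Inr (k, l)"]) (auto simp: state_def stv_def opv_def regs_def)
  qed
  have step: "slp_computes R X (state P) (stv P) M (\<lambda>x. \<kappa> (instr_val S (inp x) (slp_run S (inp x) P) a)) c0"
    if P: "\<forall>k<length P. instr_ok S I k (P ! k)" and a: "instr_ok S I (length P) a" for P a
  proof -
    have "slp_computes R X (state P) (stv P) M (\<lambda>x. \<kappa> (h (opv P a1 x) (opv P a2 x))) c0"
      if "operand_ok S I (length P) a1" "operand_ok S I (length P) a2"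
        "h \<in> {add S, \<lambda>x y. x \<ominus>\<^bsub>S\<^esub> y, mult S}" for h a1 a2
    proof (rule slp_computes_adapt[OF ops[OF that(3)], where g = "\<lambda>x. (opv P a1 x, opv P a2 x)"])
      \<comment> \<open>The programs \<open>ops\<close> are known to be right only on arguments in
        \<open>carrier S\<close>, so every operand value must be shown to lie there.\<close>
      show "(\<lambda>x. (opv P a1 x, opv P a2 x)) \<in> X \<rightarrow> carrier S \<times> carrier S"
      proof (intro funcsetI SigmaI)
        fix x assume "x \<in> X"
        with inp have x: "\<And>i. i \<in> I \<Longrightarrow> inp x i \<in> carrier S" by blast
        note closed = operand_val_closed[OF _ x slp_run_closed[OF assms(1) x P]]
        show "opv P a1 x \<in> carrier S" "opv P a2 x \<in> carrier S"
          unfolding opv_def using that(1,2) by (auto intro: closed)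
      qed
    next
      fix i :: "bool \<times> 'l" assume "i \<in> UNIV \<times> M"
      then obtain second l where i: "i = (second, l)" "l \<in> M" by blast
      then show "available R X (state P) (stv P) (\<lambda>x. (case (opv P a1 x, opv P a2 x) of
          (x, y) \<Rightarrow> \<lambda>(second, l). \<kappa> (if second then y else x) l) i)"
        using avail[OF that(1) i(2)] avail[OF that(2) i(2)] by (cases second) simp_all
    next
      fix l assume "l \<in> M"
      then show "available R X M (\<lambda>x. case (opv P a1 x, opv P a2 x) of (x, y) \<Rightarrow> \<kappa> (h x y))
          (\<lambda>x. \<kappa> (h (opv P a1 x) (opv P a2 x)) l)"
        by (intro available_input[of l]) simp_all
    qed
    note op = this
    show ?thesis
    proof (cases a)
      case (Add a1 a2)
      then show ?thesis using op[of a1 a2 "add S"] \<open>instr_ok S I (length P) a\<close> by (simp add: opv_def)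
    next
      case (Sub a1 a2)
      then show ?thesis using op[of a1 a2 "\<lambda>x y. x \<ominus>\<^bsub>S\<^esub> y"] \<open>instr_ok S I (length P) a\<close>
        by (simp add: opv_def)
    next
      case (Mul a1 a2)
      then show ?thesis using op[of a1 a2 "mult S"] \<open>instr_ok S I (length P) a\<close> by (simp add: opv_def)
    qed
  qed
  \<comment> \<open>The claim covers the whole state, not only the outputs, as later instructions
    may read every register.\<close>
  have main: "slp_computes R X (I \<times> M) inp' (state P) (stv P) (length P * c0)"
    if "\<forall>k<length P. instr_ok S I k (P ! k)" for P
    using that
  proof (induction P rule: rev_induct)
    case Nil
    have "slp_computes R X (I \<times> M) inp' (state []) (stv []) 0"
    proof (rule slp_computes_wire)
      fix j assume "j \<in> state ([] :: ('i, 'b) instr list)"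
      then obtain i where "j = Inl i" "i \<in> I \<times> M" by (auto simp: state_def)
      then show "available R X (I \<times> M) inp' (\<lambda>x. stv [] x j)"
        by (simp add: stv_def available_self)
    qed
    then show ?case by simp
  next
    case (snoc a P)
    have ok: "\<forall>k<length P. instr_ok S I k (P ! k)" "instr_ok S I (length P) a"
      using snoc.prems unfolding instrs_ok_snoc by simp_all
    \<comment> \<open>The identity program, in parallel with the new instruction, carries the old
      state along for free.\<close>
    have "slp_computes R X (state P) (stv P) (state P) (stv P) 0"
      by (rule slp_computes_refl)
    from slp_computes_compose[OF snoc.IH[OF ok(1)] slp_computes_par[OF this step[OF ok]]]
    have "slp_computes R X (I \<times> M) inp' (state (P @ [a])) (stv (P @ [a]))
        (length P * c0 + (0 + c0))"
    proof (rule slp_computes_relabel)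
      fix j assume "j \<in> state (P @ [a])"
      then consider i l where "j = Inl (i, l)" "i \<in> I" "l \<in> M"
        | k l where "j = Inr (k, l)" "k < length P" "l \<in> M"
        | l where "j = Inr (length P, l)" "l \<in> M"
        by (auto simp: state_def less_Suc_eq)
      then show "available R X (Sum_Type.Plus (state P) M) (\<lambda>x. case_sum (stv P x)
          (\<kappa> (instr_val S (inp x) (slp_run S (inp x) P) a))) (\<lambda>x. stv (P @ [a]) x j)"
      proof cases
        case 1
        then show ?thesis
          by (intro available_input[of "Inl j"]) (auto simp: state_def stv_def)
      next
        case 2
        then show ?thesis
          by (intro available_input[of "Inl j"])
             (auto simp: state_def stv_def regs_def slp_run_snoc nth_append)
      next
        case 3
        then show ?thesis
          by (intro available_input[of "Inr l"])
             (auto simp: stv_def regs_def slp_run_snoc nth_append)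
      qed
    qed
    then show ?case by (simp add: algebra_simps)
  qed
  obtain P \<sigma> where P: "length P \<le> c" "\<forall>k<length P. instr_ok S I k (P ! k)"
      "\<forall>j\<in>J. operand_ok S I (length P) (\<sigma> j)"
      "\<forall>x\<in>X. \<forall>j\<in>J. operand_val (inp x) (slp_run S (inp x) P) (\<sigma> j) = out x j"
    using S by (rule slp_computesE)
  have "slp_computes R X (I \<times> M) inp' (J \<times> M) (\<lambda>x (j, l). \<kappa> (out x j) l) (length P * c0)"
    using main[OF P(2)]
  proof (rule slp_computes_relabel)
    fix j assume "j \<in> J \<times> M"
    then obtain i l where j: "j = (i, l)" "i \<in> J" "l \<in> M" by blast
    from avail[OF P(3)[rule_format, OF j(2)] j(3)] show
      "available R X (state P) (stv P) (\<lambda>x. case j of (j, l) \<Rightarrow> \<kappa> (out x j) l)"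
      unfolding available_def opv_def using P(4) j by simp
  qed
  then show ?thesis
    unfolding inp'_def by (rule slp_computes_mono) (use P(1) in simp)
qed

text \<open>One multiplication and one addition per term, accumulated from the constant
  zero.\<close>

lemma slp_computes_inner_product:
  fixes S :: "'b ring" and i i' :: "nat \<Rightarrow> 'i"
  assumes "ring S" and inp: "\<And>x i. x \<in> X \<Longrightarrow> i \<in> I \<Longrightarrow> inp x i \<in> carrier S"
    and "\<And>b. b < L \<Longrightarrow> i b \<in> I \<and> i' b \<in> I"
  shows "slp_computes S X I inp {()} (\<lambda>x _. \<Oplus>\<^bsub>S\<^esub>b\<in>{..<L}. inp x (i b) \<otimes>\<^bsub>S\<^esub> inp x (i' b)) (2 * L)"
  using assms(3)
proof (induction L)
  case 0
  interpret ring S by fact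
  have "slp_computes S X I inp {()} (\<lambda>x _. \<Oplus>\<^bsub>S\<^esub>b\<in>{..<0::nat}. inp x (i b) \<otimes>\<^bsub>S\<^esub> inp x (i' b)) 0"
    by (rule slp_computes_wire) (simp add: available_const[of "\<zero>\<^bsub>S\<^esub>"])
  then show ?case by simp
next
  case (Suc L)
  interpret ring S by fact
  define acc where "acc x = (\<Oplus>\<^bsub>S\<^esub>b\<in>{..<L}. inp x (i b) \<otimes>\<^bsub>S\<^esub> inp x (i' b))" for x
  have acc: "slp_computes S X I inp {()} (\<lambda>x _. acc x) (2 * L)"
    unfolding acc_def using Suc by simp
  have prod: "slp_computes S X I inp {()} (\<lambda>x _. inp x (i L) \<otimes>\<^bsub>S\<^esub> inp x (i' L)) 1"
    unfolding slp_computes_def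
    by (intro exI[of _ "[Mul (Input (i L)) (Input (i' L))]"] exI[of _ "\<lambda>_. Reg 0"])
       (use Suc.prems in \<open>auto simp: slp_run_def\<close>)
  have "slp_computes S X (Sum_Type.Plus {()} {()})
      (\<lambda>x. case_sum (\<lambda>_. acc x) (\<lambda>_. inp x (i L) \<otimes>\<^bsub>S\<^esub> inp x (i' L)))
      {()} (\<lambda>x _. acc x \<oplus>\<^bsub>S\<^esub> inp x (i L) \<otimes>\<^bsub>S\<^esub> inp x (i' L)) 1"
    unfolding slp_computes_def
    by (intro exI[of _ "[Add (Input (Inl ())) (Input (Inr ()))]"] exI[of _ "\<lambda>_. Reg 0"])
       (auto simp: slp_run_def)
  from slp_computes_compose[OF slp_computes_par[OF acc prod] this]
  have "slp_computes S X I inp {()} (\<lambda>x _. acc x \<oplus>\<^bsub>S\<^esub> inp x (i L) \<otimes>\<^bsub>S\<^esub> inp x (i' L)) (2 * Suc L)"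
    by simp
  moreover have "(\<Oplus>\<^bsub>S\<^esub>b\<in>{..<Suc L}. inp x (i b) \<otimes>\<^bsub>S\<^esub> inp x (i' b))
      = acc x \<oplus>\<^bsub>S\<^esub> inp x (i L) \<otimes>\<^bsub>S\<^esub> inp x (i' L)" if "x \<in> X" for x
  proof -
    have "inp x (i b) \<in> carrier S \<and> inp x (i' b) \<in> carrier S" if "b < Suc L" for b
      using Suc.prems that \<open>x \<in> X\<close> inp by blast
    then show ?thesis
      unfolding acc_def lessThan_Suc
      by (subst finsum_insert) (auto intro!: a_comm finsum_closed)
  qed
  ultimately show ?case
    by (elim slp_computes_relabel) (simp add: available_input[of "()"])
qed

section \<open>Sums and polynomials over a commutative ring\<close>

lemma (in abelian_monoid) finsum_fibres:
  assumes "finite I" "finite K" "h \<in> I \<rightarrow> K" "c \<in> I \<rightarrow> carrier G"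
  shows "(\<Oplus>i\<in>I. c i) = (\<Oplus>k\<in>K. \<Oplus>i\<in>{i\<in>I. h i = k}. c i)"
proof -
  have "I = (\<Union>k\<in>K. {i\<in>I. h i = k})"
    using assms(3) by auto
  moreover have "(\<Oplus>i\<in>(\<Union>k\<in>K. {i\<in>I. h i = k}). c i) = (\<Oplus>k\<in>K. \<Oplus>i\<in>{i\<in>I. h i = k}. c i)"
    using assms by (intro add.finprod_UN_disjoint) (auto simp: pairwise_def disjnt_def)
  ultimately show ?thesis
    by simp
qed

lemma (in abelian_monoid) finsum_Times:
  assumes "finite A" "finite B" "\<And>i j. i \<in> A \<Longrightarrow> j \<in> B \<Longrightarrow> f i j \<in> carrier G"
  shows "(\<Oplus>i\<in>A. \<Oplus>j\<in>B. f i j) = (\<Oplus>z\<in>A \<times> B. f (fst z) (snd z))"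
proof -
  have "(\<Oplus>z\<in>A \<times> B. f (fst z) (snd z)) = (\<Oplus>i\<in>A. \<Oplus>z\<in>{z\<in>A \<times> B. fst z = i}. f (fst z) (snd z))"
    using assms by (intro finsum_fibres) auto
  also have "\<dots> = (\<Oplus>i\<in>A. \<Oplus>j\<in>B. f i j)"
  proof (intro finsum_cong' refl)
    fix i assume i: "i \<in> A"
    then have "{z\<in>A \<times> B. fst z = i} = Pair i ` B" by auto
    then show "(\<Oplus>z\<in>{z\<in>A \<times> B. fst z = i}. f (fst z) (snd z)) = (\<Oplus>j\<in>B. f i j)"
      using assms(3)[OF i] finsum_reindex[of "\<lambda>z. f (fst z) (snd z)" "Pair i" B]
      by (simp add: inj_on_def image_subset_iff_funcset[symmetric] image_subset_iff)
  qed (use assms in auto)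
  finally show ?thesis ..
qed

lemma (in semiring) finsum_mult_finsum:
  assumes "finite A" "finite B" "f \<in> A \<rightarrow> carrier R" "g \<in> B \<rightarrow> carrier R"
  shows "(\<Oplus>i\<in>A. f i) \<otimes> (\<Oplus>j\<in>B. g j) = (\<Oplus>z\<in>A \<times> B. f (fst z) \<otimes> g (snd z))"
proof -
  have "(\<Oplus>i\<in>A. f i) \<otimes> (\<Oplus>j\<in>B. g j) = (\<Oplus>i\<in>A. f i \<otimes> (\<Oplus>j\<in>B. g j))"
    using assms by (intro finsum_ldistr finsum_closed) auto
  also have "\<dots> = (\<Oplus>i\<in>A. \<Oplus>j\<in>B. f i \<otimes> g j)"
    using assms by (intro finsum_cong' refl finsum_rdistr) (auto intro!: finsum_closed m_closed)
  also have "\<dots> = (\<Oplus>z\<in>A \<times> B. f (fst z) \<otimes> g (snd z))"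
    using assms by (intro finsum_Times) auto
  finally show ?thesis .
qed

text \<open>Stated for maps that are only additive, because it is applied to a single coordinate of
  \<open>\<psi>\<close>. Preservation of zero comes from cancelling in
  \<open>h 0 + h 0 = h 0\<close>.\<close>

lemma additive_finsum:
  assumes "abelian_group S" and "abelian_group R" and h: "h \<in> carrier S \<rightarrow> carrier R"
    and add: "\<And>x y. x \<in> carrier S \<Longrightarrow> y \<in> carrier S \<Longrightarrow> h (x \<oplus>\<^bsub>S\<^esub> y) = h x \<oplus>\<^bsub>R\<^esub> h y"
    and "finite A" "f \<in> A \<rightarrow> carrier S"
  shows "h (\<Oplus>\<^bsub>S\<^esub>i\<in>A. f i) = (\<Oplus>\<^bsub>R\<^esub>i\<in>A. h (f i))"
  using assms(5,6)
proof (induction A)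
  case empty
  interpret S: abelian_group S by fact
  interpret R: abelian_group R by fact
  have "h \<zero>\<^bsub>S\<^esub> \<in> carrier R" "h \<zero>\<^bsub>S\<^esub> \<oplus>\<^bsub>R\<^esub> h \<zero>\<^bsub>S\<^esub> = h \<zero>\<^bsub>S\<^esub>"
    using h add[of "\<zero>\<^bsub>S\<^esub>" "\<zero>\<^bsub>S\<^esub>"] by auto
  then have "h \<zero>\<^bsub>S\<^esub> = \<zero>\<^bsub>R\<^esub>"
    by simp
  then show ?case
    by simp
next
  case (insert i A)
  interpret S: abelian_group S by fact
  interpret R: abelian_group R by fact
  have "(\<lambda>i. h (f i)) \<in> insert i A \<rightarrow> carrier R" and f: "f \<in> insert i A \<rightarrow> carrier S"
    using h insert.prems by auto
  then show ?case
    using insert.hyps insert.IH add[of "f i" "finsum S f A"]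
    by (simp add: S.finsum_closed Pi_def)
qed

text \<open>Division with remainder by \<open>h\<close> is the inverse. The same map numbers
  positions in a matrix cut into blocks and the exponents of \<open>f\<close>.\<close>

lemma bij_betw_mult_add:
  "bij_betw (\<lambda>(j, b). j * h + b) ({..<w} \<times> {..<h}) {..<w * h :: nat}"
proof (rule bij_betw_byWitness[where f' = "\<lambda>q. (q div h, q mod h)"])
  have "j * h + b < w * h" if "j < w" "b < h" for j b
  proof -
    have "j * h + b < Suc j * h" using that by simp
    also have "\<dots> \<le> w * h" using that by (intro mult_le_mono1) simp
    finally show ?thesis .
  qed
  then show "(\<lambda>(j, b). j * h + b) ` ({..<w} \<times> {..<h}) \<subseteq> {..<w * h}"
    by auto
  show "(\<lambda>q. (q div h, q mod h)) ` {..<w * h} \<subseteq> {..<w} \<times> {..<h}"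
    by (cases "h = 0") (auto simp: less_mult_imp_div_less)
qed auto

text \<open>\<open>poly_at\<close> and the scheme are defined for plain records of type
  \<open>'b ring\<close>, whereas \<open>cring\<close> allows record extensions; the locale fixes
  the plain type.\<close>

locale commutative_ring = cring S for S :: "'b ring" (structure)
begin

section \<open>Polynomials given by coefficient functions\<close>

lemma poly_at_closed:
  assumes "a \<in> {..<l} \<rightarrow> carrier S" "x \<in> carrier S"
  shows "poly_at S l a x \<in> carrier S"
  using assms unfolding poly_at_def by (intro finsum_closed) auto

lemma poly_at_cong:
  assumes "\<And>k. k < l \<Longrightarrow> a k = b k" "b \<in> {..<l} \<rightarrow> carrier S" "x \<in> carrier S"
  shows "poly_at S l a x = poly_at S l b x"
  using assms unfolding poly_at_def by (intro finsum_cong') auto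

text \<open>Horner's rule, the recursion on which synthetic division runs.\<close>

lemma poly_at_shift:
  assumes "a \<in> {..<Suc l} \<rightarrow> carrier S" "x \<in> carrier S"
  shows "poly_at S (Suc l) a x = a 0 \<oplus> x \<otimes> poly_at S l (\<lambda>k. a (Suc k)) x"
proof -
  have a: "a k \<in> carrier S" if "k < Suc l" for k
    using assms(1) that by auto
  have "poly_at S (Suc l) a x = a 0 \<otimes> x [^] (0::nat) \<oplus> (\<Oplus>k\<in>Suc ` {..<l}. a k \<otimes> x [^] k)"
    unfolding poly_at_def lessThan_Suc_eq_insert_0 using a assms(2) by (subst finsum_insert) auto
  also have "(\<Oplus>k\<in>Suc ` {..<l}. a k \<otimes> x [^] k) = (\<Oplus>k\<in>{..<l}. x \<otimes> (a (Suc k) \<otimes> x [^] k))"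
    using a assms(2) by (subst finsum_reindex) (auto intro!: finsum_cong' simp: m_ac)
  also have "\<dots> = x \<otimes> poly_at S l (\<lambda>k. a (Suc k)) x"
    unfolding poly_at_def using a assms(2) by (intro finsum_rdistr[symmetric]) auto
  finally show ?thesis
    using a assms(2) by simp
qed

lemma poly_at_add:
  assumes "a \<in> {..<l} \<rightarrow> carrier S" "b \<in> {..<l} \<rightarrow> carrier S" "x \<in> carrier S"
  shows "poly_at S l (\<lambda>k. a k \<oplus> b k) x = poly_at S l a x \<oplus> poly_at S l b x"
proof -
  have "poly_at S l (\<lambda>k. a k \<oplus> b k) x = (\<Oplus>k\<in>{..<l}. a k \<otimes> x [^] k \<oplus> b k \<otimes> x [^] k)"
    unfolding poly_at_def using assms by (intro finsum_cong' refl l_distr) auto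
  also have "\<dots> = poly_at S l a x \<oplus> poly_at S l b x"
    unfolding poly_at_def using assms by (intro finsum_addf) auto
  finally show ?thesis .
qed

text \<open>Serves in two ways: it collects the coefficients of \<open>h = f g\<close>, where
  exponents collide, and it pads \<open>f\<close> and \<open>g\<close> to a prescribed length, where
  an exponent that does not occur gets the empty sum.\<close>

lemma poly_at_monomials:
  assumes "finite I" "h \<in> I \<rightarrow> {..<l}" "c \<in> I \<rightarrow> carrier S" "x \<in> carrier S"
  shows "(\<Oplus>i\<in>I. c i \<otimes> x [^] h i) = poly_at S l (\<lambda>k. \<Oplus>i\<in>{i\<in>I. h i = k}. c i) x"
proof -
  have "(\<Oplus>i\<in>I. c i \<otimes> x [^] h i) = (\<Oplus>k\<in>{..<l}. \<Oplus>i\<in>{i\<in>I. h i = k}. c i \<otimes> x [^] h i)"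
    using assms by (intro finsum_fibres) auto
  also have "\<dots> = poly_at S l (\<lambda>k. \<Oplus>i\<in>{i\<in>I. h i = k}. c i) x"
    unfolding poly_at_def
  proof (intro finsum_cong' refl)
    fix k
    have "(\<Oplus>i\<in>{i\<in>I. h i = k}. c i \<otimes> x [^] h i) = (\<Oplus>i\<in>{i\<in>I. h i = k}. c i \<otimes> x [^] k)"
      using assms by (intro finsum_cong') auto
    also have "\<dots> = (\<Oplus>i\<in>{i\<in>I. h i = k}. c i) \<otimes> x [^] k"
      using assms by (intro finsum_ldistr[symmetric]) auto
    finally show "(\<Oplus>i\<in>{i\<in>I. h i = k}. c i \<otimes> x [^] h i) = (\<Oplus>i\<in>{i\<in>I. h i = k}. c i) \<otimes> x [^] k" .
  qed (use assms in \<open>auto intro!: finsum_closed m_closed\<close>)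
  finally show ?thesis .
qed

text \<open>Division with remainder by \<open>x - y\<close>; the last clause makes the root bound below inductive.\<close>

lemma synthetic_division:
  assumes "a \<in> {..<Suc l} \<rightarrow> carrier S" "y \<in> carrier S"
  shows "\<exists>q c. q \<in> {..<l} \<rightarrow> carrier S \<and> c \<in> carrier S \<and>
    (\<forall>x\<in>carrier S. poly_at S (Suc l) a x = (x \<ominus> y) \<otimes> poly_at S l q x \<oplus> c) \<and>
    ((\<forall>k<l. q k = \<zero>) \<and> c = \<zero> \<longrightarrow> (\<forall>k<Suc l. a k = \<zero>))"
  using assms(1)
proof (induction l arbitrary: a)
  case 0
  then have a: "a 0 \<in> carrier S" by auto
  show ?case
    using a assms(2)
    by (intro exI[of _ "\<lambda>_. \<zero>"] exI[of _ "a 0"]) (auto simp: poly_at_def lessThan_Suc)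
next
  case (Suc l)
  have a: "(\<lambda>k. a (Suc k)) \<in> {..<Suc l} \<rightarrow> carrier S" "a 0 \<in> carrier S"
    using Suc.prems by auto
  from Suc.IH[OF a(1)] obtain q c where q: "q \<in> {..<l} \<rightarrow> carrier S" "c \<in> carrier S"
    and div: "\<forall>x\<in>carrier S. poly_at S (Suc l) (\<lambda>k. a (Suc k)) x = (x \<ominus> y) \<otimes> poly_at S l q x \<oplus> c"
    and zero: "(\<forall>k<l. q k = \<zero>) \<and> c = \<zero> \<longrightarrow> (\<forall>k<Suc l. a (Suc k) = \<zero>)"
    by blast
  \<comment> \<open>Read off from
    \<open>a 0 + x ((x - y) Q + c) = (x - y) (c + x Q) + (a 0 + y c)\<close>: the old remainder
    becomes the lowest coefficient of the new quotient.\<close>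
  let ?q = "case_nat c q" and ?c = "a 0 \<oplus> y \<otimes> c"
  have q': "?q \<in> {..<Suc l} \<rightarrow> carrier S"
    using q by (auto split: nat.split)
  show ?case
  proof (intro exI[of _ ?q] exI[of _ ?c] conjI ballI impI)
    show "?q \<in> {..<Suc l} \<rightarrow> carrier S" by fact
    show "?c \<in> carrier S" using a q assms(2) by simp
  next
    fix x assume x: "x \<in> carrier S"
    define Q where "Q = poly_at S l q x"
    have Q: "Q \<in> carrier S" unfolding Q_def using q x by (intro poly_at_closed)
    have "poly_at S (Suc (Suc l)) a x = a 0 \<oplus> x \<otimes> ((x \<ominus> y) \<otimes> Q \<oplus> c)"
      using poly_at_shift[OF Suc.prems x] div x by (simp add: Q_def)
    also have "\<dots> = (x \<ominus> y) \<otimes> (c \<oplus> x \<otimes> Q) \<oplus> (a 0 \<oplus> y \<otimes> c)"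
    proof -
      define z where "z = x \<ominus> y"
      have z: "z \<in> carrier S" "x = z \<oplus> y"
        unfolding z_def using x assms(2) by (auto simp: a_minus_def a_assoc l_neg)
      then have "x \<otimes> c = z \<otimes> c \<oplus> y \<otimes> c"
        using q(2) assms(2) by (simp add: l_distr)
      then show ?thesis
        unfolding z_def[symmetric] using x Q a(2) q(2) assms(2) z(1)
        by (simp only: r_distr m_lcomm[of z x] a_ac m_closed a_closed)
    qed
    also have "c \<oplus> x \<otimes> Q = poly_at S (Suc l) ?q x"
      unfolding Q_def poly_at_shift[OF q' x] by (simp only: nat.case)
    finally show "poly_at S (Suc (Suc l)) a x = (x \<ominus> y) \<otimes> poly_at S (Suc l) ?q x \<oplus> ?c" .
  next
    \<comment> \<open>The lowest coefficient of the quotient is \<open>c\<close>, so its vanishing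
      feeds the induction hypothesis and reduces the remainder to \<open>a 0\<close>.\<close>
    assume *: "(\<forall>k<Suc l. ?q k = \<zero>) \<and> ?c = \<zero>"
    have c0: "c = \<zero>"
      using conjunct1[OF *, THEN spec, of 0] by simp
    have "q k = \<zero>" if "k < l" for k
      using conjunct1[OF *, THEN spec, of "Suc k"] that by simp
    with zero c0 have "\<forall>k<Suc l. a (Suc k) = \<zero>"
      by blast
    moreover have "a 0 = \<zero>"
      using conjunct2[OF *] a(2) assms(2) unfolding c0 by simp
    ultimately have "a k = \<zero>" if "k < Suc (Suc l)" for k
      using that by (cases k) blast+
    then show "\<forall>k<Suc (Suc l). a k = \<zero>"
      by blast
  qed
qed

text \<open>With zero divisors around, a polynomial can have more roots than its degree. Here one
  root \<open>y\<close> is split off: evaluating at \<open>y\<close> shows that the remainder is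
  zero, and at every other root \<open>z\<close> the factor \<open>z - y\<close> is a unit, so the
  quotient vanishes there and the induction applies to it.\<close>

lemma exceptional_roots_zero:
  assumes "exceptional S Z" "finite Z" "card Z = l" "a \<in> {..<l} \<rightarrow> carrier S"
    and "\<And>z. z \<in> Z \<Longrightarrow> poly_at S l a z = \<zero>"
  shows "\<forall>k<l. a k = \<zero>"
  using assms
proof (induction l arbitrary: Z a)
  case (Suc l)
  then obtain y where y: "y \<in> Z"
    by (metis card.empty ex_in_conv nat.distinct(1))
  have Z: "Z \<subseteq> carrier S" and units: "\<And>x. x \<in> Z \<Longrightarrow> x \<noteq> y \<Longrightarrow> x \<ominus> y \<in> Units S"
    using Suc.prems(1) y by (auto simp: exceptional_def)
  have y': "y \<in> carrier S" using y Z by auto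
  from synthetic_division[OF Suc.prems(4) y'] obtain q c
    where q: "q \<in> {..<l} \<rightarrow> carrier S" "c \<in> carrier S"
    and div: "\<And>x. x \<in> carrier S \<Longrightarrow> poly_at S (Suc l) a x = (x \<ominus> y) \<otimes> poly_at S l q x \<oplus> c"
    and zero: "(\<forall>k<l. q k = \<zero>) \<and> c = \<zero> \<longrightarrow> (\<forall>k<Suc l. a k = \<zero>)"
    by blast
  have c: "c = \<zero>"
  proof -
    have "\<zero> = (y \<ominus> y) \<otimes> poly_at S l q y \<oplus> c"
      unfolding div[OF y', symmetric] using Suc.prems(5)[OF y] by (rule sym)
    also have "y \<ominus> y = \<zero>"
      using y' by (simp add: a_minus_def r_neg)
    finally show ?thesis
      using q(2) poly_at_closed[OF q(1) y'] by simp
  qed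
  have "\<forall>k<l. q k = \<zero>"
  proof (rule Suc.IH[of "Z - {y}"])
    show "exceptional S (Z - {y})"
      using Suc.prems(1) by (auto simp: exceptional_def)
    fix z assume z: "z \<in> Z - {y}"
    then have z': "z \<in> carrier S" using Z by blast
    have "(z \<ominus> y) \<otimes> poly_at S l q z = (z \<ominus> y) \<otimes> \<zero>"
    proof -
      have "(z \<ominus> y) \<otimes> poly_at S l q z \<oplus> \<zero> = \<zero>"
        unfolding div[OF z', unfolded c, symmetric] using Suc.prems(5)[of z] z by simp
      then show ?thesis
        using z' y' poly_at_closed[OF q(1) z'] by simp
    qed
    then show "poly_at S l q z = \<zero>"
      using units[of z] z poly_at_closed[OF q(1) z'] by simp
  qed (use Suc.prems y q in auto)
  with zero c show ?case by blast
qed simp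

text \<open>Two candidates differ by a polynomial of length \<open>l\<close> with \<open>l\<close>
  exceptional roots. Coefficient functions are extensional, so agreement below \<open>l\<close> is
  equality and the description by \<open>THE\<close> is well defined.\<close>

lemma interpolant_unique:
  assumes W: "exceptional S (\<alpha> ` W)" "inj_on \<alpha> W" "finite W" "card W = l"
    and h: "h \<in> {..<l} \<rightarrow>\<^sub>E carrier S" "\<And>i. i \<in> W \<Longrightarrow> poly_at S l h (\<alpha> i) = y i"
  shows "interpolant S l \<alpha> W y = h"
  unfolding interpolant_def
proof (rule the_equality)
  show "h \<in> {..<l} \<rightarrow>\<^sub>E carrier S \<and> (\<forall>i\<in>W. poly_at S l h (\<alpha> i) = y i)"
    using h by blast
next
  fix h' assume h': "h' \<in> {..<l} \<rightarrow>\<^sub>E carrier S \<and> (\<forall>i\<in>W. poly_at S l h' (\<alpha> i) = y i)"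
  have hc: "h \<in> {..<l} \<rightarrow> carrier S" "h' \<in> {..<l} \<rightarrow> carrier S"
    using h(1) h' by (auto simp: PiE_def)
  then have hk: "h k \<in> carrier S" "h' k \<in> carrier S" if "k < l" for k
    using that by auto
  have d: "(\<lambda>k. h' k \<ominus> h k) \<in> {..<l} \<rightarrow> carrier S"
    using hc by auto
  have "\<forall>k<l. h' k \<ominus> h k = \<zero>"
  proof (rule exceptional_roots_zero[OF W(1)])
    show "card (\<alpha> ` W) = l" using W by (simp add: card_image)
    fix z assume "z \<in> \<alpha> ` W"
    then obtain i where i: "i \<in> W" "z = \<alpha> i" by blast
    then have z: "z \<in> carrier S" using W(1) by (auto simp: exceptional_def)
    \<comment> \<open>Writing \<open>h'\<close> as \<open>(h' - h) + h\<close> makes additivity of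
      evaluation enough; subtraction needs no lemma of its own.\<close>
    have "poly_at S l (\<lambda>k. (h' k \<ominus> h k) \<oplus> h k) z = poly_at S l h' z"
    proof (rule poly_at_cong)
      show "(h' k \<ominus> h k) \<oplus> h k = h' k" if "k < l" for k
        using hk[OF that] by (simp add: a_minus_def a_assoc l_neg)
    qed (use hc z in auto)
    then have "poly_at S l (\<lambda>k. h' k \<ominus> h k) z \<oplus> y i = y i"
      using poly_at_add[OF d hc(1) z] h(2) h' i by auto
    moreover have "y i \<in> carrier S"
      using h(2)[OF i(1)] poly_at_closed[OF hc(1) z] i by auto
    ultimately show "poly_at S l (\<lambda>k. h' k \<ominus> h k) z = \<zero>"
      using poly_at_closed[OF d z] by simp
  qed (use W d in auto)
  then have "h' k = h k" if "k < l" for k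
    using hk[OF that] that r_right_minus_eq by blast
  then show "h' = h"
    using h(1) h' by (intro PiE_ext[of h' "{..<l}" "\<lambda>_. carrier S"]) auto
qed

end

section \<open>The entangled polynomial code\<close>

text \<open>The extreme case is \<open>i = u-1\<close>, \<open>j = w-1\<close>,
  \<open>k = 0\<close>, \<open>l = v-1\<close>, with sum \<open>uvw + w - 2\<close>; this is where
  the recovery threshold comes from.\<close>

lemma ep_exponent_bound:
  fixes u v w :: nat
  assumes "i < u" "j < w" "k < w" "l < v"
  shows "(i * w + j) + (w - 1 - k + l * u * w) < u * v * w + w - 1"
proof -
  have "i * w + l * u * w + w \<le> u * v * w"
  proof -
    have "Suc i * w + l * (u * w) \<le> u * w + l * (u * w)"
      using assms(1) by (intro add_right_mono mult_le_mono1) simp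
    also have "\<dots> = Suc l * (u * w)"
      by simp
    also have "\<dots> \<le> v * (u * w)"
      using assms(4) by (intro mult_le_mono1) simp
    finally show ?thesis
      by (simp add: ac_simps)
  qed
  then show ?thesis
    using assms(2,3) by linarith
qed

text \<open>Moving \<open>k\<close> to the other side and cancelling \<open>w - 1\<close> leaves
  \<open>(i + l u) w + j = (i' + l' u) w + k\<close>. The lowest digits to base \<open>w\<close>
  give \<open>j = k\<close>, and division of the rest by \<open>u\<close> separates \<open>i\<close>
  from \<open>l\<close>.\<close>

lemma ep_exponent_eq_iff:
  fixes u v w :: nat
  assumes "i < u" "j < w" "k < w" "i' < u"
  shows "(i * w + j) + (w - 1 - k + l * u * w) = i' * w + (w - 1) + l' * u * w
    \<longleftrightarrow> i = i' \<and> j = k \<and> l = l'"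
proof
  assume eq: "(i * w + j) + (w - 1 - k + l * u * w) = i' * w + (w - 1) + l' * u * w"
  have eq': "(i + l * u) * w + j = (i' + l' * u) * w + k"
    using eq assms(3) by (simp add: algebra_simps)
  have "j = ((i + l * u) * w + j) mod w" and "k = ((i' + l' * u) * w + k) mod w"
    using assms(2,3) by simp_all
  with eq' have "j = k"
    by simp
  with eq' assms(2) have "i + l * u = i' + l' * u"
    by simp
  moreover have "i = (i + l * u) mod u" "i' = (i' + l' * u) mod u" "l = (i + l * u) div u"
    "l' = (i' + l' * u) div u"
    using assms(1,4) by simp_all
  ultimately show "i = i' \<and> j = k \<and> l = l'"
    using \<open>j = k\<close> by metis
qed (use assms in simp)

text \<open>With the position \<open>(a, b)\<close> inside the blocks fixed, this is a function of
  the block index: the family of coefficients of the scalar polynomial at entry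
  \<open>(a, b)\<close> of \<open>f\<close> or \<open>g\<close>.\<close>

definition block_entry :: "nat \<Rightarrow> nat \<Rightarrow> nat \<Rightarrow> nat \<Rightarrow> (nat \<Rightarrow> nat \<Rightarrow> 'b) \<Rightarrow> nat \<Rightarrow> nat \<Rightarrow> nat \<times> nat \<Rightarrow> 'b" where
  "block_entry t r u w M a b = (\<lambda>(i, j). M (i * (t div u) + a) (j * (r div w) + b))"

text \<open>Coefficients of entry \<open>(a, c)\<close> of the matrix polynomial
  \<open>h = f g\<close>. In \<open>(b, (i, j), (k, l))\<close>, \<open>b\<close> is the inner index
  of the product of two blocks, and the pairs are the blocks of \<open>A\<close> and of
  \<open>B\<close>. The restriction matches the extensional functions among which
  \<open>interpolant\<close> chooses.\<close>

definition ep_h_coeff ::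
    "'b ring \<Rightarrow> nat \<Rightarrow> nat \<Rightarrow> nat \<Rightarrow> nat \<Rightarrow> nat \<Rightarrow> nat \<Rightarrow> (nat \<Rightarrow> nat \<Rightarrow> 'b) \<Rightarrow> (nat \<Rightarrow> nat \<Rightarrow> 'b) \<Rightarrow>
     nat \<Rightarrow> nat \<Rightarrow> nat \<Rightarrow> 'b" where
  "ep_h_coeff S t r s u v w A B a c = (\<lambda>q\<in>{..<u * v * w + w - 1}.
     \<Oplus>\<^bsub>S\<^esub>z \<in> {z \<in> {..<r div w} \<times> ({..<u} \<times> {..<w}) \<times> ({..<w} \<times> {..<v}).
        (case z of (b, (i, j), (k, l)) \<Rightarrow> (i * w + j) + (w - 1 - k + l * u * w)) = q}.
       case z of (b, ij, kl) \<Rightarrow>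
         block_entry t r u w A a b ij \<otimes>\<^bsub>S\<^esub> block_entry r s w v B b c kl)"

context commutative_ring
begin

lemma ep_f_monomials:
  assumes "\<And>z. z \<in> {..<u} \<times> {..<w} \<Longrightarrow> block_entry t r u w M a b z \<in> carrier S" "x \<in> carrier S"
  shows "ep_f S t r u w M x a b = (\<Oplus>z\<in>{..<u} \<times> {..<w}.
    block_entry t r u w M a b z \<otimes> x [^] (case z of (i, j) \<Rightarrow> i * w + j))"
proof -
  have "M (i * (t div u) + a) (j * (r div w) + b) \<in> carrier S" if "i < u" "j < w" for i j
    using assms(1)[of "(i, j)"] that by (simp add: block_entry_def)
  then have "ep_f S t r u w M x a b = (\<Oplus>z\<in>{..<u} \<times> {..<w}.
      M (fst z * (t div u) + a) (snd z * (r div w) + b) \<otimes> x [^] (fst z * w + snd z))"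
    unfolding ep_f_def using assms(2) by (intro finsum_Times) auto
  then show ?thesis
    by (simp add: block_entry_def case_prod_beta)
qed

lemma ep_g_monomials:
  assumes "\<And>z. z \<in> {..<w} \<times> {..<v} \<Longrightarrow> block_entry r s w v M b c z \<in> carrier S" "x \<in> carrier S"
  shows "ep_g S r s u v w M x b c = (\<Oplus>z\<in>{..<w} \<times> {..<v}.
    block_entry r s w v M b c z \<otimes> x [^] (case z of (k, l) \<Rightarrow> w - 1 - k + l * u * w))"
proof -
  have "M (k * (r div w) + b) (l * (s div v) + c) \<in> carrier S" if "k < w" "l < v" for k l
    using assms(1)[of "(k, l)"] that by (simp add: block_entry_def)
  then have "ep_g S r s u v w M x b c = (\<Oplus>z\<in>{..<w} \<times> {..<v}.
      M (fst z * (r div w) + b) (snd z * (s div v) + c) \<otimes> x [^] (w - 1 - fst z + snd z * u * w))"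
    unfolding ep_g_def using assms(2) by (intro finsum_Times) auto
  then show ?thesis
    by (simp add: block_entry_def case_prod_beta)
qed

text \<open>Expanding both polynomials and merging the sums over \<open>b\<close>, the blocks of
  \<open>A\<close> and the blocks of \<open>B\<close> gives one sum of monomials, to be sorted by
  exponent.\<close>

lemma ep_product_eq_poly_at:
  assumes A: "\<And>b z. b < r div w \<Longrightarrow> z \<in> {..<u} \<times> {..<w} \<Longrightarrow> block_entry t r u w A a b z \<in> carrier S"
    and B: "\<And>b z. b < r div w \<Longrightarrow> z \<in> {..<w} \<times> {..<v} \<Longrightarrow> block_entry r s w v B b c z \<in> carrier S"
    and x: "x \<in> carrier S"
  shows "ep_h_coeff S t r s u v w A B a c \<in> {..<u * v * w + w - 1} \<rightarrow>\<^sub>E carrier S"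
    and "(\<Oplus>b\<in>{..<r div w}. ep_f S t r u w A x a b \<otimes> ep_g S r s u v w B x b c)
      = poly_at S (u * v * w + w - 1) (ep_h_coeff S t r s u v w A B a c) x"
proof -
  let ?F = "{..<u} \<times> {..<w}" and ?G = "{..<w} \<times> {..<v}"
  let ?I = "{..<r div w} \<times> ?F \<times> ?G"
  let ?ex = "\<lambda>z::nat \<times> (nat \<times> nat) \<times> (nat \<times> nat).
    case z of (b, (i, j), (k, l)) \<Rightarrow> (i * w + j) + (w - 1 - k + l * u * w)"
  let ?c = "\<lambda>z::nat \<times> (nat \<times> nat) \<times> (nat \<times> nat).
    case z of (b, ij, kl) \<Rightarrow> block_entry t r u w A a b ij \<otimes> block_entry r s w v B b c kl"
  let ?f = "\<lambda>b z. block_entry t r u w A a b z \<otimes> x [^] (case z of (i, j) \<Rightarrow> i * w + j)"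
  let ?g = "\<lambda>b z. block_entry r s w v B b c z \<otimes> x [^] (case z of (k, l) \<Rightarrow> w - 1 - k + l * u * w)"
  have c: "?c \<in> ?I \<rightarrow> carrier S"
    using A B by auto
  show h: "ep_h_coeff S t r s u v w A B a c \<in> {..<u * v * w + w - 1} \<rightarrow>\<^sub>E carrier S"
    unfolding ep_h_coeff_def using A B by (auto intro!: finsum_closed)
  have f: "?f b z \<in> carrier S" if "b < r div w" "z \<in> ?F" for b z
    using A[OF that] x by simp
  have g: "?g b z \<in> carrier S" if "b < r div w" "z \<in> ?G" for b z
    using B[OF that] x by simp
  have "(\<Oplus>b\<in>{..<r div w}. ep_f S t r u w A x a b \<otimes> ep_g S r s u v w B x b c)
      = (\<Oplus>b\<in>{..<r div w}. \<Oplus>y\<in>?F \<times> ?G. ?f b (fst y) \<otimes> ?g b (snd y))"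
  proof (intro finsum_cong' refl)
    fix b assume "b \<in> {..<r div w}"
    then have b: "b < r div w" by simp
    have "ep_f S t r u w A x a b \<otimes> ep_g S r s u v w B x b c
        = (\<Oplus>z\<in>?F. ?f b z) \<otimes> (\<Oplus>z\<in>?G. ?g b z)"
      using ep_f_monomials[OF A[OF b] x] ep_g_monomials[OF B[OF b] x] by simp
    also have "\<dots> = (\<Oplus>y\<in>?F \<times> ?G. ?f b (fst y) \<otimes> ?g b (snd y))"
      by (intro finsum_mult_finsum funcsetI f[OF b] g[OF b]) simp_all
    finally show "ep_f S t r u w A x a b \<otimes> ep_g S r s u v w B x b c
        = (\<Oplus>y\<in>?F \<times> ?G. ?f b (fst y) \<otimes> ?g b (snd y))" .
  qed (use A B x in \<open>auto intro!: finsum_closed m_closed\<close>)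
  also have "\<dots> = (\<Oplus>z\<in>?I. ?f (fst z) (fst (snd z)) \<otimes> ?g (fst z) (snd (snd z)))"
  proof (rule finsum_Times)
    fix b y assume "b \<in> {..<r div w}" "y \<in> ?F \<times> ?G"
    then show "?f b (fst y) \<otimes> ?g b (snd y) \<in> carrier S"
      using f[of b "fst y"] g[of b "snd y"] by (intro m_closed[of "?f b (fst y)"]) auto
  qed simp_all
  also have "\<dots> = (\<Oplus>z\<in>?I. ?c z \<otimes> x [^] ?ex z)"
  proof (intro finsum_cong' refl)
    show "(\<lambda>z. ?c z \<otimes> x [^] ?ex z) \<in> ?I \<rightarrow> carrier S"
      by (intro funcsetI m_closed nat_pow_closed x funcset_mem[OF c])
    fix z assume "z \<in> ?I"
    then obtain b i j k l where z: "z = (b, (i, j), (k, l))" "b < r div w" "(i, j) \<in> ?F" "(k, l) \<in> ?G"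
      by auto
    show "?f (fst z) (fst (snd z)) \<otimes> ?g (fst z) (snd (snd z)) = ?c z \<otimes> x [^] ?ex z"
      using A[OF z(2,3)] B[OF z(2,4)] x z(1) nat_pow_mult[OF x, symmetric]
      by (simp add: m_ac)
  qed
  also have "\<dots> = poly_at S (u * v * w + w - 1) (\<lambda>q. \<Oplus>z\<in>{z \<in> ?I. ?ex z = q}. ?c z) x"
  proof (rule poly_at_monomials[OF _ _ c x])
    show "?ex \<in> ?I \<rightarrow> {..<u * v * w + w - 1}"
      using ep_exponent_bound by auto
  qed simp
  also have "\<dots> = poly_at S (u * v * w + w - 1) (ep_h_coeff S t r s u v w A B a c) x"
  proof (rule poly_at_cong)
    show "ep_h_coeff S t r s u v w A B a c \<in> {..<u * v * w + w - 1} \<rightarrow> carrier S"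
      using h by (auto simp: PiE_def)
  qed (use x in \<open>auto simp: ep_h_coeff_def\<close>)
  finally show "(\<Oplus>b\<in>{..<r div w}. ep_f S t r u w A x a b \<otimes> ep_g S r s u v w B x b c)
      = poly_at S (u * v * w + w - 1) (ep_h_coeff S t r s u v w A B a c) x" .
qed

text \<open>Once the exponent forces \<open>j = k\<close>, the free indices are the inner block
  \<open>j\<close> and the position \<open>b\<close> in it. Renumbering by
  \<open>j * (r div w) + b\<close> runs through all of \<open>{..<r}\<close> because
  \<open>w\<close> divides \<open>r\<close>, so the full inner product appears.\<close>

lemma ep_h_coeff_block:
  assumes A: "\<And>b z. b < r div w \<Longrightarrow> z \<in> {..<u} \<times> {..<w} \<Longrightarrow> block_entry t r u w A a b z \<in> carrier S"
    and B: "\<And>b z. b < r div w \<Longrightarrow> z \<in> {..<w} \<times> {..<v} \<Longrightarrow> block_entry r s w v B b c z \<in> carrier S"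
    and "i < u" "l < v" "0 < w" "w dvd r"
  shows "ep_h_coeff S t r s u v w A B a c (i * w + (w - 1) + l * u * w)
    = (\<Oplus>q\<in>{..<r}. A (i * (t div u) + a) q \<otimes> B q (l * (s div v) + c))"
proof -
  let ?h = "r div w"
  let ?I = "{..<?h} \<times> ({..<u} \<times> {..<w}) \<times> ({..<w} \<times> {..<v})"
  let ?c = "\<lambda>z::nat \<times> (nat \<times> nat) \<times> (nat \<times> nat).
    case z of (b, ij, kl) \<Rightarrow> block_entry t r u w A a b ij \<otimes> block_entry r s w v B b c kl"
  let ?e = "\<lambda>(j, b). (b, (i, j), (j, l))"
  let ?d = "\<lambda>q. A (i * (t div u) + a) q \<otimes> B q (l * (s div v) + c)"
  \<comment> \<open>The position lies in the restricted domain of \<open>ep_h_coeff\<close>, being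
    the exponent for \<open>j = k = 0\<close>.\<close>
  have "i * w + (w - 1) + l * u * w < u * v * w + w - 1"
    using ep_exponent_bound[of i u 0 w 0 l v] assms(3-5) by (simp add: ac_simps)
  moreover have "{z \<in> ?I. (case z of (b, (i', j), (k, l')) \<Rightarrow>
      (i' * w + j) + (w - 1 - k + l' * u * w)) = i * w + (w - 1) + l * u * w} = ?e ` ({..<w} \<times> {..<?h})"
    (is "?L = ?R")
  proof (intro equalityI subsetI)
    fix z assume "z \<in> ?L"
    then obtain b i' j k l' where z: "z = (b, (i', j), (k, l'))" "b < ?h" "i' < u" "j < w" "k < w"
      and "(i' * w + j) + (w - 1 - k + l' * u * w) = i * w + (w - 1) + l * u * w"
      by auto
    then have "i' = i" "j = k" "l' = l"
      using ep_exponent_eq_iff[of i' u j w k i l' l] assms(3) by blast+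
    then have "z = ?e (j, b)" using z by simp
    then show "z \<in> ?R" using z by blast
  next
    fix z assume "z \<in> ?R"
    then show "z \<in> ?L" using assms(3,4) by auto
  qed
  ultimately have "ep_h_coeff S t r s u v w A B a c (i * w + (w - 1) + l * u * w)
      = (\<Oplus>z\<in>?e ` ({..<w} \<times> {..<?h}). ?c z)"
    unfolding ep_h_coeff_def by simp
  also have "\<dots> = (\<Oplus>p\<in>{..<w} \<times> {..<?h}. ?c (?e p))"
    using A B assms(3,4) by (intro finsum_reindex) (auto simp: inj_on_def)
  also have "\<dots> = (\<Oplus>p\<in>{..<w} \<times> {..<?h}. ?d (case p of (j, b) \<Rightarrow> j * ?h + b))"
    by (simp add: block_entry_def case_prod_beta)
  also have "\<dots> = (\<Oplus>q\<in>(\<lambda>(j, b). j * ?h + b) ` ({..<w} \<times> {..<?h}). ?d q)"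
  proof (intro finsum_reindex[symmetric])
    have "?d (j * ?h + b) \<in> carrier S" if "j < w" "b < ?h" for j b
      using A[of b "(i, j)"] B[of b "(j, l)"] that assms(3,4) by (simp add: block_entry_def)
    then show "?d \<in> (\<lambda>(j, b). j * ?h + b) ` ({..<w} \<times> {..<?h}) \<rightarrow> carrier S"
      by auto
  qed (use bij_betw_mult_add[of ?h w] in \<open>simp add: bij_betw_def\<close>)
  also have "(\<lambda>(j, b). j * ?h + b) ` ({..<w} \<times> {..<?h}) = {..<r}"
    using bij_betw_mult_add[of ?h w] assms(6) by (simp add: bij_betw_def)
  finally show ?thesis .
qed

end

section \<open>The packed scheme\<close>

lemma block_index_less:
  assumes "u dvd t" "i < u" "a < t div u"
  shows "i * (t div u) + a < (t :: nat)"
  using bij_betw_mult_add[of "t div u" u] assms by (auto simp: bij_betw_def)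

text \<open>Since \<open>e\<close> is injective, each coefficient of the padded polynomial is a
  single available value or zero. No additions are spent on forming it, and the cost is that of one
  evaluation.\<close>

lemma (in commutative_ring) slp_computes_monomials:
  assumes "slp_computes S ({..<l} \<rightarrow>\<^sub>E carrier S) {..<l} (\<lambda>a. a) J (\<lambda>a i. poly_at S l a (\<beta> i)) cost"
    and "finite I" "inj_on e I" "e \<in> I \<rightarrow> {..<l}"
    and avail: "\<And>z. z \<in> I \<Longrightarrow> available S X P inp (\<lambda>x. c x z)"
    and c: "\<And>x z. x \<in> X \<Longrightarrow> z \<in> I \<Longrightarrow> c x z \<in> carrier S"
    and \<beta>: "\<And>i. i \<in> J \<Longrightarrow> \<beta> i \<in> carrier S"
  shows "slp_computes S X P inp J (\<lambda>x i. \<Oplus>z\<in>I. c x z \<otimes> \<beta> i [^] e z) cost"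
proof -
  define a where "a x = (\<lambda>k\<in>{..<l}. \<Oplus>z\<in>{z\<in>I. e z = k}. c x z)" for x
  have ac: "a x \<in> {..<l} \<rightarrow>\<^sub>E carrier S" if "x \<in> X" for x
    unfolding a_def using c that by (auto intro!: finsum_closed)
  show ?thesis
  proof (rule slp_computes_adapt[OF assms(1), where g = a])
    show "a \<in> X \<rightarrow> {..<l} \<rightarrow>\<^sub>E carrier S"
      using ac by blast
  next
    fix k assume k: "k \<in> {..<l}"
    show "available S X P inp (\<lambda>x. a x k)"
    proof (cases "\<exists>z\<in>I. e z = k")
      case True
      then obtain z where z: "z \<in> I" "e z = k" by blast
      then have "{z\<in>I. e z = k} = {z}"
        using assms(3) by (auto dest: inj_onD)
      then have "a x k = c x z" if "x \<in> X" for x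
        unfolding a_def using k c[OF that z(1)] by simp
      then show ?thesis
        using avail[OF z(1)] unfolding available_def by simp
    next
      case False
      then have none: "{z\<in>I. e z = k} = {}" by blast
      have "a x k = (\<Oplus>z\<in>{z\<in>I. e z = k}. c x z)" for x
        using k by (simp add: a_def)
      then have "a x k = \<zero>" for x
        unfolding none by simp
      then show ?thesis
        by (intro available_const[of "\<zero>"]) simp_all
    qed
  next
    fix i assume i: "i \<in> J"
    show "available S X J (\<lambda>x i. poly_at S l (a x) (\<beta> i)) (\<lambda>x. \<Oplus>z\<in>I. c x z \<otimes> \<beta> i [^] e z)"
    proof (rule available_input[OF i])
      fix x assume x: "x \<in> X"
      have "(\<Oplus>z\<in>I. c x z \<otimes> \<beta> i [^] e z)
          = poly_at S l (\<lambda>k. \<Oplus>z\<in>{z\<in>I. e z = k}. c x z) (\<beta> i)"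
        using assms(2,4) c[OF x] \<beta>[OF i] by (intro poly_at_monomials) auto
      also have "\<dots> = poly_at S l (a x) (\<beta> i)"
        using ac[OF x] \<beta>[OF i] by (intro poly_at_cong) (auto simp: a_def PiE_def)
      finally show "(\<Oplus>z\<in>I. c x z \<otimes> \<beta> i [^] e z) = poly_at S l (a x) (\<beta> i)" .
    qed
  qed
qed

text \<open>The abstract setting: two commutative rings with an exceptional set in the larger one.
  Galois rings enter through \<open>cring_galois_ring\<close>.\<close>

locale rmfe_scheme =
  fixes R :: "'a ring" and S :: "'b ring"
    and \<iota> :: "'a \<Rightarrow> 'b" and m :: nat and \<kappa> :: "'b \<Rightarrow> nat \<Rightarrow> 'a"
    and n :: nat and \<phi> :: "(nat \<Rightarrow> 'a) \<Rightarrow> 'b" and \<psi> :: "'b \<Rightarrow> nat \<Rightarrow> 'a"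
    and N t r s u v w :: nat and \<alpha> :: "nat \<Rightarrow> 'b"
  assumes cring_R: "cring R" and cring_S: "cring S"
    and extension: "extension_of_degree R S \<iota> m \<kappa>"
    and rmfe: "rmfe R S \<iota> n \<phi> \<psi>"
    and inj_\<alpha>: "inj_on \<alpha> {..<N}" and exceptional_\<alpha>: "exceptional S (\<alpha> ` {..<N})"
    and pos: "0 < u" "0 < v" "0 < w" and dvd: "u dvd t" "v dvd s" "w dvd r"
    and threshold_le: "u * v * w + w - 1 \<le> N"
begin

sublocale S: commutative_ring S
  using cring_S by (simp add: commutative_ring_def)

sublocale R: cring R
  by (rule cring_R)

abbreviation threshold :: nat where "threshold \<equiv> u * v * w + w - 1"

definition h_coeff where
  "h_coeff x = (\<lambda>(a, c). ep_h_coeff S t r s u v w (pack n \<phi> (fst x)) (pack n \<phi> (snd x)) a c)"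

lemma \<kappa>_closed: "y \<in> carrier S \<Longrightarrow> l < m \<Longrightarrow> \<kappa> y l \<in> carrier R"
  using extension
  by (fastforce simp: extension_of_degree_def linear_maps_def ext_module_def vec_space_def)

lemma \<alpha>_closed: "i < N \<Longrightarrow> \<alpha> i \<in> carrier S"
  using exceptional_\<alpha> by (auto simp: exceptional_def)

lemma \<phi>_closed: "x \<in> {..<n} \<rightarrow>\<^sub>E carrier R \<Longrightarrow> \<phi> x \<in> carrier S"
  using rmfe by (auto simp: rmfe_def linear_maps_def ext_module_def vec_space_def)

lemma \<psi>_closed: "y \<in> carrier S \<Longrightarrow> k < n \<Longrightarrow> \<psi> y k \<in> carrier R"
  using rmfe by (fastforce simp: rmfe_def linear_maps_def ext_module_def vec_space_def)

lemma \<psi>_add: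
  "x \<in> carrier S \<Longrightarrow> y \<in> carrier S \<Longrightarrow> k < n \<Longrightarrow> \<psi> (x \<oplus>\<^bsub>S\<^esub> y) k = \<psi> x k \<oplus>\<^bsub>R\<^esub> \<psi> y k"
  using rmfe by (simp add: rmfe_def linear_maps_def ext_module_def vec_space_def)

lemma \<psi>_mult:
  "x \<in> {..<n} \<rightarrow>\<^sub>E carrier R \<Longrightarrow> y \<in> {..<n} \<rightarrow>\<^sub>E carrier R \<Longrightarrow> k < n \<Longrightarrow>
    \<psi> (\<phi> x \<otimes>\<^bsub>S\<^esub> \<phi> y) k = x k \<otimes>\<^bsub>R\<^esub> y k"
  using rmfe by (simp add: rmfe_def vec_space_def)

lemma batch_vectors:
  assumes "(A, B) \<in> batches R n t r s"
  shows "i < t \<Longrightarrow> j < r \<Longrightarrow> (\<lambda>k\<in>{..<n}. A k i j) \<in> {..<n} \<rightarrow>\<^sub>E carrier R"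
    and "j < r \<Longrightarrow> l < s \<Longrightarrow> (\<lambda>k\<in>{..<n}. B k j l) \<in> {..<n} \<rightarrow>\<^sub>E carrier R"
  using assms by (auto simp: batches_def)

lemma pack_closed:
  assumes "(A, B) \<in> batches R n t r s"
  shows "i < t \<Longrightarrow> j < r \<Longrightarrow> pack n \<phi> A i j \<in> carrier S"
    and "j < r \<Longrightarrow> l < s \<Longrightarrow> pack n \<phi> B j l \<in> carrier S"
  unfolding pack_def using batch_vectors[OF assms] by (blast intro: \<phi>_closed)+

lemma block_entry_closed:
  assumes "(A, B) \<in> batches R n t r s"
  shows "a < t div u \<Longrightarrow> b < r div w \<Longrightarrow> z \<in> {..<u} \<times> {..<w} \<Longrightarrow>
      block_entry t r u w (pack n \<phi> A) a b z \<in> carrier S"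
    and "b < r div w \<Longrightarrow> c < s div v \<Longrightarrow> z \<in> {..<w} \<times> {..<v} \<Longrightarrow>
      block_entry r s w v (pack n \<phi> B) b c z \<in> carrier S"
  using pack_closed[OF assms] block_index_less dvd by (auto simp: block_entry_def)

section \<open>Responses as values of \<open>h\<close>, and decoding\<close>

lemma h_coeff_closed:
  assumes "x \<in> batches R n t r s" "q \<in> response_index t s u v"
  shows "h_coeff x q \<in> {..<threshold} \<rightarrow>\<^sub>E carrier S"
proof -
  obtain A B a c where x: "x = (A, B)" "q = (a, c)" "a < t div u" "c < s div v"
    using assms by (cases x; cases q) (auto simp: response_index_def)
  \<comment> \<open>The coefficients do not involve the point of evaluation, so zero can stand in
    for it.\<close>
  show ?thesis
    unfolding h_coeff_def x prod.case fst_conv snd_conv using assms x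
    by (intro S.ep_product_eq_poly_at(1)[OF _ _ S.zero_closed] block_entry_closed) auto
qed

lemma response_eq:
  assumes "x \<in> batches R n t r s" "q \<in> response_index t s u v" "i < N"
  shows "response S n \<phi> t r s u v w \<alpha> x i q = poly_at S threshold (h_coeff x q) (\<alpha> i)"
proof -
  obtain A B a c where x: "x = (A, B)" "q = (a, c)" "a < t div u" "c < s div v"
    using assms by (cases x; cases q) (auto simp: response_index_def)
  show ?thesis
    unfolding h_coeff_def x prod.case fst_conv snd_conv response_def worker_def encode_def sum.case
    using assms x
    by (intro S.ep_product_eq_poly_at(2) block_entry_closed \<alpha>_closed) auto
qed

lemma response_closed:
  assumes "x \<in> batches R n t r s" "q \<in> response_index t s u v" "i < N"
  shows "response S n \<phi> t r s u v w \<alpha> x i q \<in> carrier S"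
  using response_eq[OF assms] S.poly_at_closed[OF _ \<alpha>_closed[OF assms(3)]]
    h_coeff_closed[OF assms(1,2)] by (simp add: PiE_def)

lemma interpolant_eq:
  assumes "x \<in> batches R n t r s" "q \<in> response_index t s u v"
    and W: "W \<subseteq> {..<N}" "card W = threshold"
  shows "interpolant S threshold \<alpha> W (\<lambda>i. restrict (response S n \<phi> t r s u v w \<alpha> x) W i q)
    = h_coeff x q"
proof (rule S.interpolant_unique)
  show "exceptional S (\<alpha> ` W)"
    using exceptional_\<alpha> W(1) unfolding exceptional_def by blast
  show "inj_on \<alpha> W"
    using inj_\<alpha> W(1) by (rule inj_on_subset)
  show "finite W"
    using W(1) by (rule finite_subset) simp
  show "h_coeff x q \<in> {..<threshold} \<rightarrow>\<^sub>E carrier S"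
    using assms(1,2) by (rule h_coeff_closed)
  fix i assume "i \<in> W"
  then show "poly_at S threshold (h_coeff x q) (\<alpha> i)
      = restrict (response S n \<phi> t r s u v w \<alpha> x) W i q"
    using response_eq[OF assms(1,2), of i] W(1) by auto
qed (rule W(2))

text \<open>Here \<open>i\<close> and \<open>l\<close> are positions in the whole product matrix,
  not block indices.\<close>

abbreviation block_exponent :: "nat \<Rightarrow> nat \<Rightarrow> nat" where
  "block_exponent i l \<equiv> (i div (t div u)) * w + (w - 1) + (l div (s div v)) * u * w"

lemma block_position:
  assumes "i < t" "l < s"
  shows "(i mod (t div u), l mod (s div v)) \<in> response_index t s u v"
    and "i div (t div u) < u" and "l div (s div v) < v" and "block_exponent i l < threshold"
proof -
  \<comment> \<open>The sizes \<open>t\<close> and \<open>s\<close> may be zero in general; an entry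
    \<open>(i, l)\<close> rules this out, so blocks are nonempty and the remainders are in
    range.\<close>
  have "u \<le> t" "v \<le> s"
    using assms dvd by (auto intro: dvd_imp_le)
  then have "0 < t div u" "0 < s div v"
    using pos by (simp_all add: div_greater_zero_iff)
  then show "(i mod (t div u), l mod (s div v)) \<in> response_index t s u v"
    by (simp add: response_index_def)
  show i: "i div (t div u) < u" and l: "l div (s div v) < v"
    using assms dvd by (auto intro!: less_mult_imp_div_less)
  show "block_exponent i l < threshold"
    using ep_exponent_bound[OF i pos(3) pos(3) l] by (simp add: ac_simps)
qed

lemma decode_eq:
  assumes "x \<in> batches R n t r s" "W \<subseteq> {..<N}" "card W = threshold" "i < t" "l < s"
  shows "decode S \<psi> t s u v w \<alpha> W (restrict (response S n \<phi> t r s u v w \<alpha> x) W) (k, i, l)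
    = \<psi> (h_coeff x (i mod (t div u), l mod (s div v)) (block_exponent i l)) k"
  using interpolant_eq[OF assms(1) block_position(1)[OF assms(4,5)] assms(2,3)]
  by (simp add: decode_def ep_decode_def Let_def)

lemma recovery:
  "recovery_threshold N threshold (batches R n t r s)
    (response S n \<phi> t r s u v w \<alpha>) (decode S \<psi> t s u v w \<alpha>)
    ({..<n} \<times> {..<t} \<times> {..<s}) (batch_product R r)"
  unfolding recovery_threshold_def
proof (intro allI impI ballI)
  fix W x j
  assume W: "W \<subseteq> {..<N} \<and> card W = threshold" and x: "x \<in> batches R n t r s"
    and "j \<in> {..<n} \<times> {..<t} \<times> {..<s}"
  then obtain k i l where j: "j = (k, i, l)" "k < n" "i < t" "l < s"
    by auto
  obtain A B where AB: "x = (A, B)"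
    by (cases x)
  note batch = x[unfolded AB]
  let ?a = "i mod (t div u)" and ?c = "l mod (s div v)"
  note position = block_position[OF j(3,4)]
  have ac: "?a < t div u" "?c < s div v"
    using position(1) by (auto simp: response_index_def)
  have entry: "pack n \<phi> A i q \<in> carrier S" "pack n \<phi> B q l \<in> carrier S" if "q < r" for q
    using pack_closed[OF batch] j that by auto
  have "h_coeff x (?a, ?c) (block_exponent i l)
      = (\<Oplus>\<^bsub>S\<^esub>q\<in>{..<r}. pack n \<phi> A ((i div (t div u)) * (t div u) + ?a) q
          \<otimes>\<^bsub>S\<^esub> pack n \<phi> B q ((l div (s div v)) * (s div v) + ?c))"
    unfolding h_coeff_def AB prod.case fst_conv snd_conv
    using block_entry_closed[OF batch] ac position(2,3) pos(3) dvd(3)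
    by (intro S.ep_h_coeff_block) blast+
  then have "h_coeff x (?a, ?c) (block_exponent i l)
      = (\<Oplus>\<^bsub>S\<^esub>q\<in>{..<r}. pack n \<phi> A i q \<otimes>\<^bsub>S\<^esub> pack n \<phi> B q l)"
    unfolding div_mult_mod_eq .
  then have "decode S \<psi> t s u v w \<alpha> W (restrict (response S n \<phi> t r s u v w \<alpha> x) W) j
      = \<psi> (\<Oplus>\<^bsub>S\<^esub>q\<in>{..<r}. pack n \<phi> A i q \<otimes>\<^bsub>S\<^esub> pack n \<phi> B q l) k"
    using decode_eq[OF x _ _ j(3,4), of W k] W j(1) by simp
  also have "\<dots> = (\<Oplus>\<^bsub>R\<^esub>q\<in>{..<r}. \<psi> (pack n \<phi> A i q \<otimes>\<^bsub>S\<^esub> pack n \<phi> B q l) k)"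
  proof (rule additive_finsum[of S R "\<lambda>y. \<psi> y k"])
    show "abelian_group S" "abelian_group R"
      by (rule S.abelian_group_axioms R.abelian_group_axioms)+
    show "(\<lambda>y. \<psi> y k) \<in> carrier S \<rightarrow> carrier R"
      using \<psi>_closed j(2) by blast
    show "\<psi> (x \<oplus>\<^bsub>S\<^esub> y) k = \<psi> x k \<oplus>\<^bsub>R\<^esub> \<psi> y k" if "x \<in> carrier S" "y \<in> carrier S" for x y
      using that j(2) by (rule \<psi>_add)
  qed (use entry in auto)
  also have "\<dots> = (\<Oplus>\<^bsub>R\<^esub>q\<in>{..<r}. A k i q \<otimes>\<^bsub>R\<^esub> B k q l)"
  proof (intro R.finsum_cong' refl)
    show "(\<lambda>q. A k i q \<otimes>\<^bsub>R\<^esub> B k q l) \<in> {..<r} \<rightarrow> carrier R"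
      using batch j by (auto simp: batches_def)
    fix q assume "q \<in> {..<r}"
    then show "\<psi> (pack n \<phi> A i q \<otimes>\<^bsub>S\<^esub> pack n \<phi> B q l) k = A k i q \<otimes>\<^bsub>R\<^esub> B k q l"
      unfolding pack_def using batch_vectors[OF batch] j by (subst \<psi>_mult) auto
  qed
  finally show "decode S \<psi> t s u v w \<alpha> W (restrict (response S n \<phi> t r s u v w \<alpha> x) W) j
      = batch_product R r x j"
    by (simp add: batch_product_def AB j(1))
qed

end

section \<open>Costs of the scheme\<close>

context rmfe_scheme
begin

lemma lift:
  assumes "\<And>h. h \<in> {add S, \<lambda>x y. x \<ominus>\<^bsub>S\<^esub> y, mult S} \<Longrightarrow>
      slp_computes R (carrier S \<times> carrier S) ((UNIV :: bool set) \<times> {..<m})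
        (\<lambda>(x, y) (second, l). \<kappa> (if second then y else x) l) {..<m} (\<lambda>(x, y). \<kappa> (h x y)) c0"
    and "slp_computes S X I inp J out c"
    and "\<And>x i. x \<in> X \<Longrightarrow> i \<in> I \<Longrightarrow> inp x i \<in> carrier S"
  shows "slp_computes R X (I \<times> {..<m}) (\<lambda>x (i, l). \<kappa> (inp x i) l) (J \<times> {..<m})
    (\<lambda>x (j, l). \<kappa> (out x j) l) (c * c0)"
  by (rule slp_computes_lift[OF S.ring_axioms _ assms]) (simp_all add: \<kappa>_closed)

section \<open>Stages of encoding and decoding\<close>

definition packed where
  "packed x = case_sum (\<lambda>(i, j). pack n \<phi> (fst x) i j) (\<lambda>(j, l). pack n \<phi> (snd x) j l)"

definition packed_index :: "((nat \<times> nat) + (nat \<times> nat)) set" where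
  "packed_index = Sum_Type.Plus ({..<t} \<times> {..<r}) ({..<r} \<times> {..<s})"

lemma packed_closed:
  assumes "x \<in> batches R n t r s" "q \<in> packed_index"
  shows "packed x q \<in> carrier S"
  using assms pack_closed[of "fst x" "snd x"] by (auto simp: packed_def packed_index_def)

lemma packing_cost:
  assumes "slp_computes R ({..<n} \<rightarrow>\<^sub>E carrier R) {..<n} (\<lambda>x. x) {..<m} (\<lambda>x. \<kappa> (\<phi> x)) c"
  shows "slp_computes R (batches R n t r s) (batch_index n t r s) batch_entry
    (packed_index \<times> {..<m}) (\<lambda>x (q, l). \<kappa> (packed x q) l) (card packed_index * c)"
proof (rule slp_computes_family)
  show "finite packed_index"
    by (simp add: packed_index_def)
  fix q assume q: "q \<in> packed_index"
  \<comment> \<open>The vector across the batch at one matrix position, which is what a single call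
    of \<open>\<phi>\<close> consumes.\<close>
  define entry where "entry x = (\<lambda>k\<in>{..<n}. case q of Inl (i, j) \<Rightarrow> fst x k i j | Inr (j, l) \<Rightarrow> snd x k j l)"
    for x :: "(nat \<Rightarrow> nat \<Rightarrow> nat \<Rightarrow> 'a) \<times> (nat \<Rightarrow> nat \<Rightarrow> nat \<Rightarrow> 'a)"
  have packed: "packed x q = \<phi> (entry x)" for x
    by (cases q) (simp_all add: packed_def pack_def entry_def case_prod_beta)
  show "slp_computes R (batches R n t r s) (batch_index n t r s) batch_entry {..<m} (\<lambda>x. \<kappa> (packed x q)) c"
  proof (rule slp_computes_adapt[OF assms, where g = entry])
    show "entry \<in> batches R n t r s \<rightarrow> {..<n} \<rightarrow>\<^sub>E carrier R"
      using q by (auto simp: entry_def batches_def packed_index_def split: if_splits)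
  next
    fix k assume k: "k \<in> {..<n}"
    show "available R (batches R n t r s) (batch_index n t r s) batch_entry (\<lambda>x. entry x k)"
    proof (cases q)
      case (Inl ij)
      then show ?thesis
        using k q by (intro available_input[of "Inl (k, ij)"])
          (auto simp: entry_def batch_entry_def batch_index_def packed_index_def)
    next
      case (Inr jl)
      then show ?thesis
        using k q by (intro available_input[of "Inr (k, jl)"])
          (auto simp: entry_def batch_entry_def batch_index_def packed_index_def)
    qed
  next
    fix l assume l: "l \<in> {..<m}"
    show "available R (batches R n t r s) {..<m} (\<lambda>x. \<kappa> (\<phi> (entry x))) (\<lambda>x. \<kappa> (packed x q) l)"
      unfolding packed by (rule available_self[OF l])
  qed
qed

text \<open>For each entry of a share, a single evaluation at \<open>N\<close> points serves all
  workers at once. Both \<open>f\<close> (exponents below \<open>u * w\<close>) and \<open>g\<close>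
  (exponents below the threshold) fit into length \<open>N\<close> after padding.\<close>

lemma evaluation_cost:
  assumes eval: "slp_computes S ({..<N} \<rightarrow>\<^sub>E carrier S) {..<N} (\<lambda>a. a) {..<N}
      (\<lambda>a i. poly_at S N a (\<alpha> i)) c"
  shows "slp_computes S (batches R n t r s) packed_index packed (share_index t r s u v w \<times> {..<N})
    (\<lambda>x (q, i). encode S n \<phi> t r s u v w \<alpha> x i q) (card (share_index t r s u v w) * c)"
proof (rule slp_computes_family)
  show "finite (share_index t r s u v w)"
    by (simp add: share_index_def)
  fix q assume "q \<in> share_index t r s u v w"
  then consider a b where "q = Inl (a, b)" "a < t div u" "b < r div w"
    | b c where "q = Inr (b, c)" "b < r div w" "c < s div v"
    by (auto simp: share_index_def)
  then show "slp_computes S (batches R n t r s) packed_index packed {..<N}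
    (\<lambda>x i. encode S n \<phi> t r s u v w \<alpha> x i q) c"
  proof cases
    case (1 a b)
    let ?c = "\<lambda>x. block_entry t r u w (pack n \<phi> (fst x)) a b"
    let ?e = "\<lambda>(i, j). i * w + j"
    have closed: "?c x z \<in> carrier S" if "x \<in> batches R n t r s" "z \<in> {..<u} \<times> {..<w}" for x z
      using block_entry_closed(1)[of "fst x" "snd x", OF _ 1(2,3) that(2)] that(1) by simp
    have "slp_computes S (batches R n t r s) packed_index packed {..<N}
        (\<lambda>x i. \<Oplus>\<^bsub>S\<^esub>z\<in>{..<u} \<times> {..<w}. ?c x z \<otimes>\<^bsub>S\<^esub> \<alpha> i [^]\<^bsub>S\<^esub> (?e z)) c"
    proof (rule S.slp_computes_monomials[OF eval])
      show "inj_on ?e ({..<u} \<times> {..<w})"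
        using bij_betw_mult_add[of w u] by (simp add: bij_betw_def)
      have "u * w \<le> u * v * w + w - 1"
      proof -
        have "1 * (u * w) \<le> v * (u * w)"
          using pos by (intro mult_le_mono1) simp
        then have "u * w \<le> u * v * w"
          by (simp add: ac_simps)
        with pos show ?thesis by linarith
      qed
      with threshold_le have "u * w \<le> N"
        by linarith
      moreover have "?e ` ({..<u} \<times> {..<w}) = {..<u * w}"
        using bij_betw_mult_add[of w u] by (simp add: bij_betw_def)
      ultimately show "?e \<in> {..<u} \<times> {..<w} \<rightarrow> {..<N}"
        by (metis image_subset_iff_funcset lessThan_subset_iff)
    next
      fix z assume z: "z \<in> {..<u} \<times> {..<w}"
      then obtain i j where z': "z = (i, j)" "i < u" "j < w" by auto
      show "available S (batches R n t r s) packed_index packed (\<lambda>x. ?c x z)"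
        using z' block_index_less[OF dvd(1) z'(2) 1(2)] block_index_less[OF dvd(3) z'(3) 1(3)]
        by (intro available_input[of "Inl (i * (t div u) + a, j * (r div w) + b)"])
           (auto simp: packed_index_def packed_def block_entry_def)
    qed (use closed \<alpha>_closed in auto)
    then show ?thesis
    proof (rule slp_computes_relabel)
      fix i assume i: "i \<in> {..<N}"
      show "available S (batches R n t r s) {..<N}
          (\<lambda>x i. \<Oplus>\<^bsub>S\<^esub>z\<in>{..<u} \<times> {..<w}. ?c x z \<otimes>\<^bsub>S\<^esub> \<alpha> i [^]\<^bsub>S\<^esub> (?e z))
          (\<lambda>x. encode S n \<phi> t r s u v w \<alpha> x i q)"
      proof (rule available_input[OF i])
        fix x assume x: "x \<in> batches R n t r s"
        have "ep_f S t r u w (pack n \<phi> (fst x)) (\<alpha> i) a b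
            = (\<Oplus>\<^bsub>S\<^esub>z\<in>{..<u} \<times> {..<w}. ?c x z \<otimes>\<^bsub>S\<^esub> \<alpha> i [^]\<^bsub>S\<^esub> (?e z))"
          using S.ep_f_monomials[OF closed[OF x]] \<alpha>_closed i by simp
        then show "encode S n \<phi> t r s u v w \<alpha> x i q
            = (\<Oplus>\<^bsub>S\<^esub>z\<in>{..<u} \<times> {..<w}. ?c x z \<otimes>\<^bsub>S\<^esub> \<alpha> i [^]\<^bsub>S\<^esub> (?e z))"
          by (simp add: encode_def 1(1) case_prod_beta)
      qed
    qed
  next
    case (2 b c')
    let ?c = "\<lambda>x. block_entry r s w v (pack n \<phi> (snd x)) b c'"
    let ?e = "\<lambda>(k, l). w - 1 - k + l * u * w"
    have closed: "?c x z \<in> carrier S" if "x \<in> batches R n t r s" "z \<in> {..<w} \<times> {..<v}" for x z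
      using block_entry_closed(2)[of "fst x" "snd x", OF _ 2(2,3) that(2)] that(1) by simp
    have "slp_computes S (batches R n t r s) packed_index packed {..<N}
        (\<lambda>x i. \<Oplus>\<^bsub>S\<^esub>z\<in>{..<w} \<times> {..<v}. ?c x z \<otimes>\<^bsub>S\<^esub> \<alpha> i [^]\<^bsub>S\<^esub> (?e z)) c"
    proof (rule S.slp_computes_monomials[OF eval])
      show "inj_on ?e ({..<w} \<times> {..<v})"
      proof (rule inj_onI)
        fix y z assume "y \<in> {..<w} \<times> {..<v}" "z \<in> {..<w} \<times> {..<v}" and eq: "?e y = ?e z"
        then obtain k l k' l' where yz: "y = (k, l)" "z = (k', l')" "k < w" "k' < w"
          by auto
        \<comment> \<open>Equality of two exponents of \<open>g\<close> becomes an instance of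
          \<open>ep_exponent_eq_iff\<close> after adding \<open>k'\<close> to both sides, with
          \<open>i = 0\<close> and \<open>j = k'\<close>.\<close>
        with eq have "(0 * w + k') + (w - 1 - k + l * u * w) = 0 * w + (w - 1) + l' * u * w"
          by simp
        from this[unfolded ep_exponent_eq_iff[OF pos(1) yz(4,3) pos(1)]] show "y = z"
          using yz by simp
      qed
      show "?e \<in> {..<w} \<times> {..<v} \<rightarrow> {..<N}"
      proof (rule funcsetI)
        fix z assume "z \<in> {..<w} \<times> {..<v}"
        then obtain k l where "z = (k, l)" "k < w" "l < v"
          by auto
        then show "?e z \<in> {..<N}"
          using ep_exponent_bound[OF pos(1,3), of k l v] threshold_le by simp
      qed
    next
      fix z assume z: "z \<in> {..<w} \<times> {..<v}"
      then obtain k l where z': "z = (k, l)" "k < w" "l < v" by auto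
      show "available S (batches R n t r s) packed_index packed (\<lambda>x. ?c x z)"
        using z' block_index_less[OF dvd(3) z'(2) 2(2)] block_index_less[OF dvd(2) z'(3) 2(3)]
        by (intro available_input[of "Inr (k * (r div w) + b, l * (s div v) + c')"])
           (auto simp: packed_index_def packed_def block_entry_def)
    qed (use closed \<alpha>_closed in auto)
    then show ?thesis
    proof (rule slp_computes_relabel)
      fix i assume i: "i \<in> {..<N}"
      show "available S (batches R n t r s) {..<N}
          (\<lambda>x i. \<Oplus>\<^bsub>S\<^esub>z\<in>{..<w} \<times> {..<v}. ?c x z \<otimes>\<^bsub>S\<^esub> \<alpha> i [^]\<^bsub>S\<^esub> (?e z))
          (\<lambda>x. encode S n \<phi> t r s u v w \<alpha> x i q)"
      proof (rule available_input[OF i])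
        fix x assume x: "x \<in> batches R n t r s"
        have "ep_g S r s u v w (pack n \<phi> (snd x)) (\<alpha> i) b c'
            = (\<Oplus>\<^bsub>S\<^esub>z\<in>{..<w} \<times> {..<v}. ?c x z \<otimes>\<^bsub>S\<^esub> \<alpha> i [^]\<^bsub>S\<^esub> (?e z))"
          using S.ep_g_monomials[OF closed[OF x]] \<alpha>_closed i by simp
        then show "encode S n \<phi> t r s u v w \<alpha> x i q
            = (\<Oplus>\<^bsub>S\<^esub>z\<in>{..<w} \<times> {..<v}. ?c x z \<otimes>\<^bsub>S\<^esub> \<alpha> i [^]\<^bsub>S\<^esub> (?e z))"
          by (simp add: encode_def 2(1) case_prod_beta)
      qed
    qed
  qed
qed

text \<open>Interpolation programs index their points by \<open>{..<threshold}\<close>, so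
  \<open>e\<close> enumerates the responding workers. Each entry of the responses needs one
  interpolation, whose input is the list of values of \<open>h_coeff x q\<close>.\<close>

lemma interpolation_cost:
  assumes W: "W \<subseteq> {..<N}" "bij_betw e {..<threshold} W"
    and interp: "slp_computes S ({..<threshold} \<rightarrow>\<^sub>E carrier S) {..<threshold}
      (\<lambda>a i. poly_at S threshold a (\<alpha> (e i))) {..<threshold} (\<lambda>a. a) c"
  shows "slp_computes S (batches R n t r s) (W \<times> response_index t s u v)
    (\<lambda>x (i, q). response S n \<phi> t r s u v w \<alpha> x i q) (response_index t s u v \<times> {..<threshold})
    (\<lambda>x (q, k). h_coeff x q k) (card (response_index t s u v) * c)"
proof (rule slp_computes_family)
  show "finite (response_index t s u v)"
    by (simp add: response_index_def)
  fix q assume q: "q \<in> response_index t s u v"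
  show "slp_computes S (batches R n t r s) (W \<times> response_index t s u v)
    (\<lambda>x (i, q). response S n \<phi> t r s u v w \<alpha> x i q) {..<threshold} (\<lambda>x. h_coeff x q) c"
  proof (rule slp_computes_adapt[OF interp, where g = "\<lambda>x. h_coeff x q"])
    show "(\<lambda>x. h_coeff x q) \<in> batches R n t r s \<rightarrow> {..<threshold} \<rightarrow>\<^sub>E carrier S"
      using h_coeff_closed[OF _ q] by blast
  next
    fix i assume "i \<in> {..<threshold}"
    then have i: "e i \<in> W" "e i < N"
      using W by (auto simp: bij_betw_def)
    show "available S (batches R n t r s) (W \<times> response_index t s u v)
      (\<lambda>x (i, q). response S n \<phi> t r s u v w \<alpha> x i q) (\<lambda>x. poly_at S threshold (h_coeff x q) (\<alpha> (e i)))"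
      using i q response_eq[OF _ q i(2)] by (intro available_input[of "(e i, q)"]) simp_all
  next
    fix k assume "k \<in> {..<threshold}"
    then show "available S (batches R n t r s) {..<threshold} (\<lambda>x. h_coeff x q) (\<lambda>x. h_coeff x q k)"
      by (rule available_self)
  qed
qed

text \<open>One call of \<open>\<psi>\<close> per entry of the product yields that entry for all
  \<open>n\<close> matrices. Its argument is one of the interpolated coefficients, so selecting it
  is free.\<close>

lemma unpacking_cost:
  assumes W: "W \<subseteq> {..<N}" "card W = threshold"
    and unpack: "slp_computes R (carrier S) {..<m} \<kappa> {..<n} \<psi> c"
  shows "slp_computes R (batches R n t r s) ((response_index t s u v \<times> {..<threshold}) \<times> {..<m})
    (\<lambda>x (j, l). \<kappa> (case j of (q, k) \<Rightarrow> h_coeff x q k) l) (({..<t} \<times> {..<s}) \<times> {..<n})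
    (\<lambda>x (il, k). decode S \<psi> t s u v w \<alpha> W (restrict (response S n \<phi> t r s u v w \<alpha> x) W) (k, il))
    (card ({..<t} \<times> {..<s}) * c)"
proof (rule slp_computes_family)
  fix il assume "il \<in> {..<t} \<times> {..<s}"
  then obtain i l where il: "il = (i, l)" "i < t" "l < s"
    by auto
  let ?q = "(i mod (t div u), l mod (s div v))"
  note position = block_position[OF il(2,3)]
  show "slp_computes R (batches R n t r s) ((response_index t s u v \<times> {..<threshold}) \<times> {..<m})
    (\<lambda>x (j, l). \<kappa> (case j of (q, k) \<Rightarrow> h_coeff x q k) l) {..<n}
    (\<lambda>x k. decode S \<psi> t s u v w \<alpha> W (restrict (response S n \<phi> t r s u v w \<alpha> x) W) (k, il)) c"
  proof (rule slp_computes_adapt[OF unpack, where g = "\<lambda>x. h_coeff x ?q (block_exponent i l)"])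
    show "(\<lambda>x. h_coeff x ?q (block_exponent i l)) \<in> batches R n t r s \<rightarrow> carrier S"
    proof (rule funcsetI)
      fix x assume "x \<in> batches R n t r s"
      from PiE_mem[OF h_coeff_closed[OF this position(1)]]
      show "h_coeff x ?q (block_exponent i l) \<in> carrier S"
        using position(4) by blast
    qed
  next
    fix l' assume "l' \<in> {..<m}"
    then show "available R (batches R n t r s) ((response_index t s u v \<times> {..<threshold}) \<times> {..<m})
      (\<lambda>x (j, l). \<kappa> (case j of (q, k) \<Rightarrow> h_coeff x q k) l)
      (\<lambda>x. \<kappa> (h_coeff x ?q (block_exponent i l)) l')"
      using position(1,4) by (intro available_input[of "((?q, block_exponent i l), l')"]) simp_all
  next
    fix k assume k: "k \<in> {..<n}"
    show "available R (batches R n t r s) {..<n} (\<lambda>x. \<psi> (h_coeff x ?q (block_exponent i l)))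
      (\<lambda>x. decode S \<psi> t s u v w \<alpha> W (restrict (response S n \<phi> t r s u v w \<alpha> x) W) (k, il))"
      unfolding il(1) using decode_eq[OF _ W il(2,3)] by (intro available_input[OF k]) simp
  qed
qed simp

section \<open>Complete programs over the base ring\<close>

context
  fixes c0 :: nat
  assumes ops: "\<And>h. h \<in> {add S, \<lambda>x y. x \<ominus>\<^bsub>S\<^esub> y, mult S} \<Longrightarrow>
      slp_computes R (carrier S \<times> carrier S) ((UNIV :: bool set) \<times> {..<m})
        (\<lambda>(x, y) (second, l). \<kappa> (if second then y else x) l) {..<m} (\<lambda>(x, y). \<kappa> (h x y)) c0"
begin

lemma encoding_program:
  assumes "slp_computes R ({..<n} \<rightarrow>\<^sub>E carrier R) {..<n} (\<lambda>x. x) {..<m} (\<lambda>x. \<kappa> (\<phi> x)) c1"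
    and "slp_computes S ({..<N} \<rightarrow>\<^sub>E carrier S) {..<N} (\<lambda>a. a) {..<N}
      (\<lambda>a i. poly_at S N a (\<alpha> i)) c2"
  shows "encoding_cost R S \<kappa> N m n \<phi> t r s u v w \<alpha>
    (card packed_index * c1 + card (share_index t r s u v w) * c2 * c0)"
  unfolding encoding_cost_def
  using slp_computes_compose[OF packing_cost[OF assms(1)] lift[OF ops evaluation_cost[OF assms(2)] packed_closed]]
proof (rule slp_computes_relabel)
  fix j assume "j \<in> upload_index N m t r s u v w"
  then obtain i q l where "j = (i, q, l)" "((q, i), l) \<in> (share_index t r s u v w \<times> {..<N}) \<times> {..<m}"
    by (auto simp: upload_index_def)
  then show "available R (batches R n t r s) ((share_index t r s u v w \<times> {..<N}) \<times> {..<m})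
      (\<lambda>x (j, l). \<kappa> (case j of (q, i) \<Rightarrow> encode S n \<phi> t r s u v w \<alpha> x i q) l)
      (\<lambda>x. case j of (i, q, l) \<Rightarrow> \<kappa> (encode S n \<phi> t r s u v w \<alpha> x i q) l)"
    by (intro available_input[of "((q, i), l)"]) simp_all
qed

lemma decoding_program:
  assumes W: "W \<subseteq> {..<N}" "bij_betw e {..<threshold} W"
    and "slp_computes S ({..<threshold} \<rightarrow>\<^sub>E carrier S) {..<threshold}
      (\<lambda>a i. poly_at S threshold a (\<alpha> (e i))) {..<threshold} (\<lambda>a. a) c1"
    and "slp_computes R (carrier S) {..<m} \<kappa> {..<n} \<psi> c2"
  shows "decoding_cost R S \<kappa> m n \<phi> \<psi> t r s u v w \<alpha> W
    (card (response_index t s u v) * c1 * c0 + card ({..<t} \<times> {..<s}) * c2)"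
proof -
  have card: "card W = threshold"
    using bij_betw_same_card[OF W(2)] by simp
  have "slp_computes R (batches R n t r s) (download_index W m t s u v)
      (\<lambda>x (i, q, l). \<kappa> (response S n \<phi> t r s u v w \<alpha> x i q) l)
      ((response_index t s u v \<times> {..<threshold}) \<times> {..<m})
      (\<lambda>x (j, l). \<kappa> (case j of (q, k) \<Rightarrow> h_coeff x q k) l) (card (response_index t s u v) * c1 * c0)"
  proof (rule slp_computes_adapt[where g = "\<lambda>x. x"])
    show "slp_computes R (batches R n t r s) ((W \<times> response_index t s u v) \<times> {..<m})
      (\<lambda>x (j, l). \<kappa> (case j of (i, q) \<Rightarrow> response S n \<phi> t r s u v w \<alpha> x i q) l)
      ((response_index t s u v \<times> {..<threshold}) \<times> {..<m})
      (\<lambda>x (j, l). \<kappa> (case j of (q, k) \<Rightarrow> h_coeff x q k) l) (card (response_index t s u v) * c1 * c0)"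
      using response_closed W(1) by (intro lift[OF ops interpolation_cost[OF assms(1-3)]]) auto
  next
    fix j assume "j \<in> (W \<times> response_index t s u v) \<times> {..<m}"
    then obtain i q l where "j = ((i, q), l)" "(i, q, l) \<in> download_index W m t s u v"
      by (auto simp: download_index_def)
    then show "available R (batches R n t r s) (download_index W m t s u v)
        (\<lambda>x (i, q, l). \<kappa> (response S n \<phi> t r s u v w \<alpha> x i q) l)
        (\<lambda>x. case j of (j, l) \<Rightarrow> \<kappa> (case j of (i, q) \<Rightarrow> response S n \<phi> t r s u v w \<alpha> x i q) l)"
      by (intro available_input[of "(i, q, l)"]) simp_all
  next
    fix j assume "j \<in> (response_index t s u v \<times> {..<threshold}) \<times> {..<m}"
    then show "available R (batches R n t r s) ((response_index t s u v \<times> {..<threshold}) \<times> {..<m})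
        (\<lambda>x (j, l). \<kappa> (case j of (q, k) \<Rightarrow> h_coeff x q k) l)
        (\<lambda>x. case j of (j, l) \<Rightarrow> \<kappa> (case j of (q, k) \<Rightarrow> h_coeff x q k) l)"
      by (rule available_self)
  qed simp
  from slp_computes_compose[OF this unpacking_cost[OF W(1) card assms(4)]]
  show ?thesis
    unfolding decoding_cost_def
  proof (rule slp_computes_relabel)
    fix j assume "j \<in> {..<n} \<times> {..<t} \<times> {..<s}"
    then obtain k il where "j = (k, il)" "(il, k) \<in> ({..<t} \<times> {..<s}) \<times> {..<n}"
      by auto
    then show "available R (batches R n t r s) (({..<t} \<times> {..<s}) \<times> {..<n})
        (\<lambda>x (il, k). decode S \<psi> t s u v w \<alpha> W (restrict (response S n \<phi> t r s u v w \<alpha> x) W) (k, il))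
        (\<lambda>x. decode S \<psi> t s u v w \<alpha> W (restrict (response S n \<phi> t r s u v w \<alpha> x) W) j)"
      by (intro available_input[of "(il, k)"]) simp_all
  qed
qed

text \<open>Schoolbook multiplication of the two blocks, one inner product of length
  \<open>r div w\<close> per entry of the response. The dummy index \<open>()\<close> is the single
  output of an inner product.\<close>

lemma worker_program:
  "worker_cost R S \<kappa> m t r s u v w (card (response_index t s u v) * (2 * (r div w)) * c0)"
  unfolding worker_cost_def
proof (rule slp_computes_relabel)
  let ?X = "share_index t r s u v w \<rightarrow> carrier S"
  have "slp_computes S ?X (share_index t r s u v w) (\<lambda>sh. sh)
      (response_index t s u v \<times> {()}) (\<lambda>sh (q, _). worker S r w sh q)
      (card (response_index t s u v) * (2 * (r div w)))"
  proof (rule slp_computes_family)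
    fix q assume "q \<in> response_index t s u v"
    then obtain a c where q: "q = (a, c)" "a < t div u" "c < s div v"
      by (auto simp: response_index_def)
    have "slp_computes S ?X (share_index t r s u v w) (\<lambda>sh. sh) {()}
        (\<lambda>sh _. \<Oplus>\<^bsub>S\<^esub>b\<in>{..<r div w}. sh (Inl (a, b)) \<otimes>\<^bsub>S\<^esub> sh (Inr (b, c))) (2 * (r div w))"
      using q by (intro slp_computes_inner_product S.ring_axioms) (auto simp: share_index_def)
    then show "slp_computes S ?X (share_index t r s u v w) (\<lambda>sh. sh) {()}
        (\<lambda>sh _. worker S r w sh q) (2 * (r div w))"
      by (simp add: worker_def q(1))
  qed (simp add: response_index_def)
  then show "slp_computes R ?X (share_index t r s u v w \<times> {..<m}) (\<lambda>sh (q, l). \<kappa> (sh q) l)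
      ((response_index t s u v \<times> {()}) \<times> {..<m})
      (\<lambda>sh (j, l). \<kappa> (case j of (q, _) \<Rightarrow> worker S r w sh q) l)
      (card (response_index t s u v) * (2 * (r div w)) * c0)"
    by (intro lift[OF ops]) auto
next
  fix j assume "j \<in> response_index t s u v \<times> {..<m}"
  then obtain q l where "j = (q, l)" "q \<in> response_index t s u v" "l < m"
    by auto
  then show "available R (share_index t r s u v w \<rightarrow> carrier S)
      ((response_index t s u v \<times> {()}) \<times> {..<m})
      (\<lambda>sh (j, l). \<kappa> (case j of (q, _) \<Rightarrow> worker S r w sh q) l)
      (\<lambda>sh. case j of (q, l) \<Rightarrow> \<kappa> (worker S r w sh q) l)"
    by (intro available_input[of "((q, ()), l)"]) simp_all
qed

end

end

section \<open>Asymptotics\<close>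

lemma lg_ge_1: "1 \<le> lg x" and llg_ge_1: "1 \<le> llg x"
  by (simp_all add: lg_def llg_def)

lemma lg_mono: "0 < x \<Longrightarrow> x \<le> y \<Longrightarrow> lg x \<le> lg y"
  unfolding lg_def by (intro max.mono) simp_all

lemma llg_mono: "0 < x \<Longrightarrow> x \<le> y \<Longrightarrow> llg x \<le> llg y"
  unfolding llg_def using lg_mono[of x y] lg_ge_1[of x] lg_ge_1[of y] by (intro max.mono) simp_all

lemma quasilinear_nonneg: "0 \<le> quasilinear k"
  using llg_ge_1[of "real k"] by (simp add: quasilinear_def)

text \<open>The factor 2 is a crude bound for \<open>1 / ln 2\<close>, obtained from
  \<open>exp (1/2) \<le> 2\<close>.\<close>

lemma llg_le_lg: "llg x \<le> 2 * lg x"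
proof -
  have "1 / 2 \<le> ln (2 :: real)"
    by (rule ln_ge_iff[THEN iffD2, OF _ exp_half_le2]) simp
  moreover have "ln (lg x) \<le> lg x"
    using ln_le_minus_one[of "lg x"] lg_ge_1[of x] by linarith
  ultimately have "ln (lg x) \<le> (2 * ln 2) * lg x"
    using lg_ge_1[of x] mult_right_mono[of 1 "2 * ln 2" "lg x"] by linarith
  then have "log 2 (lg x) \<le> 2 * lg x"
    by (simp add: log_def field_simps)
  then show ?thesis
    unfolding llg_def using lg_ge_1[of x] by simp
qed

text \<open>Taking logarithms gives \<open>lg m \<le> 2 * llg x\<close> and then
  \<open>llg m \<le> 2 * lg m \<le> 4 * llg x\<close>; the constant 16 is
  \<open>2 * 2 * 4\<close>.\<close>

lemma quasilinear_le:
  assumes "real m \<le> 2 * lg x"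
  shows "quasilinear m \<le> 16 * real m * llg x ^ 3"
proof (cases "m = 0")
  case False
  have "log 2 (real m) \<le> log 2 (2 * lg x)"
    using False assms by simp
  also have "\<dots> = 1 + log 2 (lg x)"
    using lg_ge_1[of x] by (simp add: log_mult)
  also have "\<dots> \<le> 2 * llg x"
    using llg_ge_1[of x] unfolding llg_def by linarith
  finally have lg: "lg (real m) \<le> 2 * llg x"
    using llg_ge_1[of x] by (simp add: lg_def)
  then have "llg (real m) \<le> 4 * llg x"
    using llg_le_lg[of "real m"] by linarith
  moreover have "(lg (real m))\<^sup>2 \<le> (2 * llg x)\<^sup>2"
    using lg lg_ge_1[of "real m"] by (intro power_mono) simp_all
  ultimately have "(lg (real m))\<^sup>2 * llg (real m) \<le> (2 * llg x)\<^sup>2 * (4 * llg x)"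
    using llg_ge_1[of "real m"] by (intro mult_mono) simp_all
  then have "real m * ((lg (real m))\<^sup>2 * llg (real m)) \<le> real m * ((2 * llg x)\<^sup>2 * (4 * llg x))"
    by (intro mult_left_mono) simp_all
  then show ?thesis
    by (simp add: quasilinear_def power2_eq_square power3_eq_cube algebra_simps)
qed (simp add: quasilinear_def)

text \<open>Base \<open>p \<ge> 2\<close> and division by \<open>d \<ge> 1\<close> only lower the
  logarithm to base 2. Rounding up adds less than 1, which \<open>lg \<ge> 1\<close> absorbs at the
  price of the factor 2.\<close>

lemma packing_length_bounds:
  assumes "2 \<le> p" "1 \<le> d" "2 \<le> N" and m: "m = nat \<lceil>log (real p) (real N) / real d\<rceil>"
  shows "1 \<le> m" and "real m \<le> 2 * lg (real N)"
proof -
  let ?y = "log (real p) (real N) / real d"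
  have "0 < log (real p) (real N)"
    using assms by simp
  then have "0 < ?y"
    using assms by simp
  then show "1 \<le> m"
    unfolding m by linarith
  have "?y \<le> log (real p) (real N)"
    using \<open>0 < log (real p) (real N)\<close> assms(2) by (simp add: divide_le_eq)
  also have "\<dots> \<le> log 2 (real N)"
    using assms(1,3) unfolding log_def by (intro divide_left_mono) simp_all
  also have "\<dots> \<le> lg (real N)"
    by (simp add: lg_def)
  finally have "?y \<le> lg (real N)" .
  moreover have "real m \<le> ?y + 1"
    unfolding m using \<open>0 < ?y\<close> by linarith
  ultimately show "real m \<le> 2 * lg (real N)"
    using lg_ge_1[of "real N"] by linarith
qed

text \<open>Roles: \<open>T\<close> is the leading term, \<open>D\<close> a combination of cost
  constants, \<open>Q\<close> stands for \<open>quasilinear m\<close> and \<open>L\<close> for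
  \<open>llg N\<close>. The bound on \<open>Q\<close> is linear in \<open>m\<close>, hence in
  \<open>n\<close>, and this \<open>n\<close> cancels.\<close>

lemma amortized_bound:
  fixes c n T D Q L m K C :: real
  assumes "c \<le> T * D * Q * L" "0 \<le> T" "0 \<le> D" "1 \<le> L" "Q \<le> 16 * m * L ^ 3"
    and "m \<le> K * n" "0 < n" "16 * K * D \<le> C"
  shows "c / n \<le> C * T * L ^ 4"
proof -
  have "16 * m * L ^ 3 \<le> 16 * (K * n) * L ^ 3"
    using assms by (intro mult_right_mono) simp_all
  with assms(5) have "Q \<le> 16 * (K * n) * L ^ 3"
    by linarith
  then have "T * D * Q * L \<le> T * D * (16 * (K * n) * L ^ 3) * L"
    using assms by (intro mult_right_mono mult_left_mono) simp_all
  also have "\<dots> = (16 * K * D) * (T * L ^ 4 * n)"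
    by (simp add: power4_eq_xxxx power3_eq_cube)
  also have "\<dots> \<le> C * (T * L ^ 4 * n)"
    using assms by (intro mult_right_mono) simp_all
  finally show ?thesis
    using assms(1,7) by (simp add: divide_le_eq mult.assoc)
qed

lemma cring_galois_ring:
  assumes "prime p" "1 \<le> e" "galois_modulus p e d f"
  shows "cring (galois_ring p e f)"
proof -
  have "1 < int p ^ e"
    using prime_gt_1_nat[OF assms(1)] assms(2) by (intro one_less_power) simp_all
  then have "cring (residue_ring (int p ^ e))"
    using residues.cring[of "int p ^ e"] by (simp add: residues_def)
  then interpret UP_cring "residue_ring (int p ^ e)" "UP (residue_ring (int p ^ e))"
    by (simp add: UP_cring_def)
  have "ideal (PIdl\<^bsub>UP (residue_ring (int p ^ e))\<^esub> f) (UP (residue_ring (int p ^ e)))"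
    using assms(3) by (intro P.cgenideal_ideal) (simp add: galois_modulus_def)
  then show ?thesis
    unfolding galois_ring_def using P.cring_axioms by (rule ideal.quotient_is_cring)
qed

context rmfe_scheme
begin

section \<open>Index sets compared with \<open>N\<close> and the threshold\<close>

lemma card_share_index:
  "real (card (share_index t r s u v w)) = real (t * r) / real (u * w) + real (r * s) / real (w * v)"
  using dvd by (simp add: share_index_def card_Plus card_cartesian_product real_of_nat_div)

lemma card_response_index: "real (card (response_index t s u v)) = real (t * s) / real (u * v)"
  using dvd by (simp add: response_index_def card_cartesian_product real_of_nat_div)

lemma uv_le_threshold: "u * v \<le> threshold" and uw_le_threshold: "u * w \<le> threshold"
  and wv_le_threshold: "w * v \<le> threshold"
proof -
  have "u * v * 1 \<le> u * v * w" "u * w * 1 \<le> u * w * v" "w * v * 1 \<le> w * v * u"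
    using pos by (intro mult_le_mono2; simp)+
  then show "u * v \<le> threshold" "u * w \<le> threshold" "w * v \<le> threshold"
    using pos(3) by (simp_all only: mult_1_right ac_simps)
qed

lemma card_packed_index:
  "real (card packed_index) \<le> (real (t * r) / real (u * w) + real (r * s) / real (w * v)) * real N"
proof -
  have le: "u * w \<le> N" "w * v \<le> N"
    using uw_le_threshold wv_le_threshold threshold_le by linarith+
  have "real (t * r) = real (t * r) / real (u * w) * real (u * w)"
    using pos by simp
  also have "\<dots> \<le> real (t * r) / real (u * w) * real N"
    using le by (intro mult_left_mono of_nat_mono) simp_all
  finally have tr: "real (t * r) \<le> real (t * r) / real (u * w) * real N" .
  have "real (r * s) = real (r * s) / real (w * v) * real (w * v)"
    using pos by simp
  also have "\<dots> \<le> real (r * s) / real (w * v) * real N"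
    using le by (intro mult_left_mono of_nat_mono) simp_all
  finally have rs: "real (r * s) \<le> real (r * s) / real (w * v) * real N" .
  have "real (card packed_index) = real (t * r) + real (r * s)"
    by (simp add: packed_index_def card_Plus card_cartesian_product)
  with tr rs show ?thesis
    unfolding distrib_right by linarith
qed

end

locale amortized_scheme = rmfe_scheme +
  fixes K_m :: real
  assumes N_ge_2: "2 \<le> N" and m_le: "real m \<le> K_m * real n"
    and m_ge_1: "1 \<le> m" and m_lg: "real m \<le> 2 * lg (real N)"
begin

text \<open>The product \<open>K_m * n\<close> is at least \<open>m \<ge> 1\<close>; so
  \<open>n\<close> is not zero, amortizing is meaningful, and \<open>K_m\<close> has the sign of the
  product.\<close>

lemma n_pos: "0 < real n" and K_m_pos: "0 < K_m"
proof -
  have *: "0 < K_m * real n"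
    using m_le m_ge_1 by linarith
  then have "n \<noteq> 0"
    by (intro notI) simp
  then show "0 < real n"
    by simp
  with * show "0 < K_m"
    by (simp add: zero_less_mult_iff)
qed

lemma amortize:
  assumes "real c \<le> X * real m" "0 \<le> X" "K_m \<le> C"
  shows "real c / real n \<le> C * X"
proof -
  have "K_m * real n \<le> C * real n"
    using assms(3) by (rule mult_right_mono) simp
  with m_le have "X * real m \<le> X * (C * real n)"
    using assms(2) by (intro mult_left_mono) linarith+
  with assms(1) show ?thesis
    using n_pos by (simp add: divide_le_eq mult_ac)
qed

lemma upload_amortized:
  assumes "K_m \<le> C"
  shows "real (card (upload_index N m t r s u v w)) / real n
    \<le> C * ((real (t * r) / real (u * w) + real (r * s) / real (w * v)) * real N)"
  unfolding card_share_index[symmetric]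
  by (rule amortize[OF _ _ assms]) (simp_all add: upload_index_def card_cartesian_product)

lemma download_amortized:
  assumes "K_m \<le> C" "card W = threshold"
  shows "real (card (download_index W m t s u v)) / real n
    \<le> C * (real (t * s) / real (u * v) * real threshold)"
  unfolding card_response_index[symmetric]
  by (rule amortize[OF _ _ assms(1)]) (simp_all add: download_index_def card_cartesian_product assms(2))

text \<open>The sum in \<open>C\<close> has one summand per source of cost: calls of
  \<open>\<phi>\<close> or \<open>\<psi>\<close>, polynomial operations carried out in the
  extension, and the two operations per term of an inner product. The 16 is that of
  \<open>quasilinear_le\<close>.\<close>

context
  fixes K_arith K_poly K_rmfe C :: real
  assumes arith: "arithmetic_cost R S m \<kappa> K_arith" and poly: "polynomial_cost S K_poly"
    and rmfe_cost: "rmfe_cost R S n m \<kappa> \<phi> \<psi> K_rmfe"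
    and C: "16 * K_m * (\<bar>K_rmfe\<bar> + \<bar>K_poly\<bar> * \<bar>K_arith\<bar> + 2 * \<bar>K_arith\<bar>) \<le> C"
begin

text \<open>\<open>arithmetic_cost\<close> supplies a separate count for each operation; the rounded
  real bound dominates all three, as lifting needs a single one.\<close>

definition op_cost :: nat where "op_cost = nat \<lfloor>K_arith * quasilinear m\<rfloor>"

lemma op_cost:
  assumes "h \<in> {add S, \<lambda>x y. x \<ominus>\<^bsub>S\<^esub> y, mult S}"
  shows "slp_computes R (carrier S \<times> carrier S) ((UNIV :: bool set) \<times> {..<m})
    (\<lambda>(x, y) (second, l). \<kappa> (if second then y else x) l) {..<m} (\<lambda>(x, y). \<kappa> (h x y)) op_cost"
proof -
  obtain c where c: "slp_computes R (carrier S \<times> carrier S) ((UNIV :: bool set) \<times> {..<m})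
      (\<lambda>(x, y) (second, l). \<kappa> (if second then y else x) l) {..<m} (\<lambda>(x, y). \<kappa> (h x y)) c"
    "real c \<le> K_arith * quasilinear m"
    using bspec[OF arith[unfolded arithmetic_cost_def] assms] by blast
  from c(2) have "c \<le> op_cost"
    unfolding op_cost_def by (rule le_nat_floor)
  with c(1) show ?thesis
    by (rule slp_computes_mono)
qed

lemma op_cost_le: "real op_cost \<le> \<bar>K_arith\<bar> * quasilinear m"
proof -
  have "K_arith * quasilinear m \<le> \<bar>K_arith\<bar> * quasilinear m"
    using quasilinear_nonneg by (intro mult_right_mono) simp_all
  moreover have "0 \<le> \<bar>K_arith\<bar> * quasilinear m"
    using quasilinear_nonneg by simp
  ultimately show ?thesis
    unfolding op_cost_def by linarith
qed

lemma weaken_abs: "real c \<le> K * quasilinear l \<Longrightarrow> real c \<le> \<bar>K\<bar> * quasilinear l"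
  using mult_right_mono[OF abs_ge_self quasilinear_nonneg, of K l] by linarith

lemma amortized_cost:
  assumes "real c \<le> T * D * quasilinear m * llg (real N)" "0 \<le> T" "0 \<le> D"
    and "D \<le> \<bar>K_rmfe\<bar> + \<bar>K_poly\<bar> * \<bar>K_arith\<bar> + 2 * \<bar>K_arith\<bar>"
  shows "real c / real n \<le> C * T * llg (real N) ^ 4"
proof (rule amortized_bound[OF assms(1-3) llg_ge_1 quasilinear_le[OF m_lg] m_le n_pos])
  have "16 * K_m * D \<le> 16 * K_m * (\<bar>K_rmfe\<bar> + \<bar>K_poly\<bar> * \<bar>K_arith\<bar> + 2 * \<bar>K_arith\<bar>)"
    using assms(4) K_m_pos by (intro mult_left_mono) simp_all
  with C show "16 * K_m * D \<le> C"
    by linarith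
qed

text \<open>Encoding is the case \<open>l = N\<close>, decoding the case \<open>l = R\<close>; \<open>x\<close> counts the uses of \<open>\<phi>\<close> or \<open>\<psi>\<close>,
  and \<open>y\<close> the polynomials evaluated or interpolated.\<close>

lemma combine_costs:
  assumes "real x \<le> T * l" "real y = T" "0 \<le> T" "1 \<le> l" "l \<le> real N"
    and "real c1 \<le> \<bar>K_rmfe\<bar> * quasilinear m" "real c2 \<le> \<bar>K_poly\<bar> * (l * (lg l)\<^sup>2 * llg l)"
  shows "real (x * c1 + y * c2 * op_cost)
    \<le> (T * l * (lg l)\<^sup>2) * (\<bar>K_rmfe\<bar> + \<bar>K_poly\<bar> * \<bar>K_arith\<bar>) * quasilinear m * llg (real N)"
proof -
  let ?Q = "quasilinear m" and ?L = "llg (real N)"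
  have L: "llg l \<le> ?L" "1 \<le> ?L"
    using assms(4,5) by (auto intro: llg_mono llg_ge_1)
  have lg2: "1 \<le> (lg l)\<^sup>2"
    using lg_ge_1 by simp
  \<comment> \<open>The part from the RMFE carries neither logarithmic factor. Both are at least 1,
    so they may be inserted to match the polynomial part.\<close>
  have "1 * 1 \<le> (lg l)\<^sup>2 * ?L"
    using lg2 L(2) by (intro mult_mono) simp_all
  then have "(T * l) * (\<bar>K_rmfe\<bar> * ?Q) * 1 \<le> (T * l) * (\<bar>K_rmfe\<bar> * ?Q) * ((lg l)\<^sup>2 * ?L)"
    using assms(3,4) quasilinear_nonneg[of m] by (intro mult_left_mono) simp_all
  moreover have "real x * real c1 \<le> (T * l) * (\<bar>K_rmfe\<bar> * ?Q)"
    using assms(1,3,4,6) by (intro mult_mono) simp_all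
  moreover have "real y * real c2 * real op_cost
      \<le> T * (\<bar>K_poly\<bar> * (l * (lg l)\<^sup>2 * ?L)) * (\<bar>K_arith\<bar> * ?Q)"
  proof (intro mult_mono op_cost_le)
    have "\<bar>K_poly\<bar> * (l * (lg l)\<^sup>2 * llg l) \<le> \<bar>K_poly\<bar> * (l * (lg l)\<^sup>2 * ?L)"
      using L assms(4) by (intro mult_left_mono) simp_all
    with assms(7) show "real c2 \<le> \<bar>K_poly\<bar> * (l * (lg l)\<^sup>2 * ?L)"
      by linarith
  qed (use assms L in simp_all)
  ultimately show ?thesis
    by (simp add: algebra_simps)
qed

lemma encoding_amortized:
  "\<exists>c. encoding_cost R S \<kappa> N m n \<phi> t r s u v w \<alpha> c \<and>
     real c / real n
       \<le> C * (real (t * r * v + s * r * u) / real (u * v * w) * real N * (lg (real N))\<^sup>2)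
           * llg (real N) ^ 4"
proof -
  let ?T = "real (t * r) / real (u * w) + real (r * s) / real (w * v)"
  have T: "real (t * r * v + s * r * u) / real (u * v * w) = ?T"
    using pos by (simp add: field_simps)
  obtain c1 where c1: "slp_computes R ({..<n} \<rightarrow>\<^sub>E carrier R) {..<n} (\<lambda>x. x) {..<m} (\<lambda>x. \<kappa> (\<phi> x)) c1"
      "real c1 \<le> K_rmfe * quasilinear m"
    using rmfe_cost unfolding rmfe_cost_def by blast
  obtain c2 where c2: "slp_computes S ({..<N} \<rightarrow>\<^sub>E carrier S) {..<N} (\<lambda>a. a) {..<N}
      (\<lambda>a i. poly_at S N a (\<alpha> i)) c2" "real c2 \<le> K_poly * quasilinear N"
    using poly[unfolded polynomial_cost_def, rule_format, of N \<alpha>] N_ge_2 inj_\<alpha> exceptional_\<alpha> by auto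
  have bound: "real (card packed_index * c1 + card (share_index t r s u v w) * c2 * op_cost)
      \<le> (?T * real N * (lg (real N))\<^sup>2) * (\<bar>K_rmfe\<bar> + \<bar>K_poly\<bar> * \<bar>K_arith\<bar>) * quasilinear m * llg (real N)"
    by (rule combine_costs[OF card_packed_index card_share_index _ _ _ weaken_abs[OF c1(2)]
          weaken_abs[OF c2(2), unfolded quasilinear_def]])
       (use N_ge_2 in simp_all)
  have "real (card packed_index * c1 + card (share_index t r s u v w) * c2 * op_cost) / real n
      \<le> C * (?T * real N * (lg (real N))\<^sup>2) * llg (real N) ^ 4"
    by (rule amortized_cost[OF bound]) simp_all
  with encoding_program[OF op_cost c1(1) c2(1)] show ?thesis
    unfolding T by blast
qed

lemma decoding_amortized:
  assumes W: "W \<subseteq> {..<N}" "card W = threshold"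
  shows "\<exists>c. decoding_cost R S \<kappa> m n \<phi> \<psi> t r s u v w \<alpha> W c \<and>
     real c / real n
       \<le> C * (real (t * s) / real (u * v) * real threshold * (lg (real threshold))\<^sup>2)
           * llg (real N) ^ 4"
proof -
  let ?T = "real (t * s) / real (u * v)"
  have "finite W"
    using W(1) by (rule finite_subset) simp
  from ex_bij_betw_nat_finite[OF this] obtain e where e: "bij_betw e {..<threshold} W"
    unfolding W(2) atLeast0LessThan by blast
  have "1 \<le> threshold"
    using uv_le_threshold pos by (metis One_nat_def Suc_leI le_trans nat_0_less_mult_iff)
  moreover have "inj_on (\<alpha> \<circ> e) {..<threshold}"
    using e inj_on_subset[OF inj_\<alpha> W(1)] by (intro comp_inj_on) (auto simp: bij_betw_def)
  moreover have "exceptional S ((\<alpha> \<circ> e) ` {..<threshold})"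
    using e exceptional_\<alpha> W(1) unfolding image_comp[symmetric] bij_betw_def exceptional_def by blast
  ultimately obtain c1 where c1: "slp_computes S ({..<threshold} \<rightarrow>\<^sub>E carrier S) {..<threshold}
      (\<lambda>a i. poly_at S threshold a (\<alpha> (e i))) {..<threshold} (\<lambda>a. a) c1"
      "real c1 \<le> K_poly * quasilinear threshold"
    using poly[unfolded polynomial_cost_def, rule_format, of threshold "\<alpha> \<circ> e"] by auto
  obtain c2 where c2: "slp_computes R (carrier S) {..<m} \<kappa> {..<n} \<psi> c2"
      "real c2 \<le> K_rmfe * quasilinear m"
    using rmfe_cost unfolding rmfe_cost_def by blast
  \<comment> \<open>Unpacking runs over all entries of the product; \<open>u * v \<le> R\<close>
    brings this below the number of response entries times \<open>R\<close>.\<close>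
  have "real (card ({..<t} \<times> {..<s})) = ?T * real (u * v)"
    using pos by (simp add: card_cartesian_product)
  also have "\<dots> \<le> ?T * real threshold"
    using uv_le_threshold by (intro mult_left_mono of_nat_mono) simp_all
  finally have ts: "real (card ({..<t} \<times> {..<s})) \<le> ?T * real threshold" .
  have l: "1 \<le> real threshold" "real threshold \<le> real N"
    using of_nat_mono[OF \<open>1 \<le> threshold\<close>, where 'a = real] of_nat_mono[OF threshold_le, where 'a = real]
    by (simp_all only: of_nat_1)
  have "real (card ({..<t} \<times> {..<s}) * c2 + card (response_index t s u v) * c1 * op_cost)
      \<le> (?T * real threshold * (lg (real threshold))\<^sup>2) * (\<bar>K_rmfe\<bar> + \<bar>K_poly\<bar> * \<bar>K_arith\<bar>)
        * quasilinear m * llg (real N)"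
    by (rule combine_costs[OF ts card_response_index _ l weaken_abs[OF c2(2)]
          weaken_abs[OF c1(2), unfolded quasilinear_def]]) simp
  then have bound: "real (card (response_index t s u v) * c1 * op_cost + card ({..<t} \<times> {..<s}) * c2)
      \<le> (?T * real threshold * (lg (real threshold))\<^sup>2) * (\<bar>K_rmfe\<bar> + \<bar>K_poly\<bar> * \<bar>K_arith\<bar>)
        * quasilinear m * llg (real N)"
    by (simp only: add.commute)
  have "real (card (response_index t s u v) * c1 * op_cost + card ({..<t} \<times> {..<s}) * c2) / real n
      \<le> C * (?T * real threshold * (lg (real threshold))\<^sup>2) * llg (real N) ^ 4"
    by (rule amortized_cost[OF bound]) simp_all
  with decoding_program[OF op_cost W(1) e c1(1) c2(1)] show ?thesis
    by blast
qed

lemma worker_amortized: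
  "\<exists>c. worker_cost R S \<kappa> m t r s u v w c \<and>
     real c / real n \<le> C * (real (t * r * s) / real (u * v * w)) * llg (real N) ^ 4"
proof -
  let ?T = "real (t * r * s) / real (u * v * w)"
  have "real (card (response_index t s u v) * (2 * (r div w)) * op_cost)
      = (real (t * s) / real (u * v)) * (2 * (real r / real w)) * real op_cost"
    unfolding card_response_index[symmetric] using dvd(3) by (simp add: real_of_nat_div)
  also have "\<dots> = ?T * 2 * real op_cost"
    by simp
  also have "\<dots> \<le> ?T * 2 * (\<bar>K_arith\<bar> * quasilinear m)"
    by (intro mult_left_mono op_cost_le) simp
  \<comment> \<open>A worker does no fast evaluation; the extra factor \<open>llg N\<close> is
    inserted only to share one exponent with encoding and decoding.\<close>
  also have "\<dots> = ?T * (2 * \<bar>K_arith\<bar>) * quasilinear m * 1"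
    by simp
  also have "\<dots> \<le> ?T * (2 * \<bar>K_arith\<bar>) * quasilinear m * llg (real N)"
    using quasilinear_nonneg by (intro mult_left_mono llg_ge_1) simp
  finally have bound: "real (card (response_index t s u v) * (2 * (r div w)) * op_cost)
      \<le> ?T * (2 * \<bar>K_arith\<bar>) * quasilinear m * llg (real N)" .
  have "real (card (response_index t s u v) * (2 * (r div w)) * op_cost) / real n
      \<le> C * ?T * llg (real N) ^ 4"
    by (rule amortized_cost[OF bound]) simp_all
  with worker_program[OF op_cost] show ?thesis
    by blast
qed

end

end

theorem theorem3p2:
  fixes p e d :: nat
    and K_m K_arith K_poly K_rmfe :: real
  assumes "prime p" and "1 \<le> e" and "1 \<le> d"
  shows "\<exists>(C :: real) (k :: nat). 0 < C \<and>
    (\<forall>(n :: nat) (m :: nat) (N :: nat) (t :: nat) (r :: nat) (s :: nat)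
      (u :: nat) (v :: nat) (w :: nat) f g GR GRm \<iota> \<kappa> \<phi> \<psi> \<alpha> R.
       2 \<le> N \<and>
       m = nat \<lceil>log (real p) (real N) / real d\<rceil> \<and> real m \<le> K_m * real n \<and>
       galois_modulus p e d f \<and> GR = galois_ring p e f \<and>
       galois_modulus p e (d * m) g \<and> GRm = galois_ring p e g \<and>
       extension_of_degree GR GRm \<iota> m \<kappa> \<and>
       rmfe GR GRm \<iota> n \<phi> \<psi> \<and>
       inj_on \<alpha> {..<N} \<and> exceptional GRm (\<alpha> ` {..<N}) \<and>
       0 < u \<and> 0 < v \<and> 0 < w \<and> u dvd t \<and> v dvd s \<and> w dvd r \<and>
       R = u * v * w + w - 1 \<and> R \<le> N
     \<longrightarrow>
       recovery_threshold N R (batches GR n t r s)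
         (response GRm n \<phi> t r s u v w \<alpha>) (decode GRm \<psi> t s u v w \<alpha>)
         ({..<n} \<times> {..<t} \<times> {..<s}) (batch_product GR r) \<and>
       real (card (upload_index N m t r s u v w)) / real n
         \<le> C * ((real (t * r) / real (u * w) + real (r * s) / real (w * v)) * real N) \<and>
       (\<forall>W. W \<subseteq> {..<N} \<and> card W = R \<longrightarrow>
          real (card (download_index W m t s u v)) / real n
            \<le> C * (real (t * s) / real (u * v) * real R)) \<and>
       (arithmetic_cost GR GRm m \<kappa> K_arith \<and> polynomial_cost GRm K_poly \<and>
        rmfe_cost GR GRm n m \<kappa> \<phi> \<psi> K_rmfe
        \<longrightarrow>
          (\<exists>c. encoding_cost GR GRm \<kappa> N m n \<phi> t r s u v w \<alpha> c \<and>
             real c / real n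
               \<le> C * (real (t * r * v + s * r * u) / real (u * v * w) * real N * (lg (real N))\<^sup>2)
                   * llg (real N) ^ k) \<and>
          (\<forall>W. W \<subseteq> {..<N} \<and> card W = R \<longrightarrow>
             (\<exists>c. decoding_cost GR GRm \<kappa> m n \<phi> \<psi> t r s u v w \<alpha> W c \<and>
                real c / real n
                  \<le> C * (real (t * s) / real (u * v) * real R * (lg (real R))\<^sup>2)
                      * llg (real N) ^ k)) \<and>
          (\<exists>c. worker_cost GR GRm \<kappa> m t r s u v w c \<and>
             real c / real n
               \<le> C * (real (t * r * s) / real (u * v * w)) * llg (real N) ^ k)))"
proof -
  let ?D = "16 * K_m * (\<bar>K_rmfe\<bar> + \<bar>K_poly\<bar> * \<bar>K_arith\<bar> + 2 * \<bar>K_arith\<bar>)"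
  \<comment> \<open>The 1 ensures positivity, \<open>K_m\<close> covers communication and
    \<open>?D\<close> computation. All are fixed before the instance is chosen, and
    \<open>p\<close>, \<open>e\<close>, \<open>d\<close> do not enter.\<close>
  let ?C = "max 1 (max K_m ?D)"
  have C: "0 < ?C" "K_m \<le> ?C" "?D \<le> ?C"
    by (simp_all only: less_max_iff_disj le_max_iff_disj) simp_all
  have scheme: "amortized_scheme GR GRm \<iota> m \<kappa> n \<phi> \<psi> N t r s u v w \<alpha> K_m"
    if "2 \<le> N" "m = nat \<lceil>log (real p) (real N) / real d\<rceil>" "real m \<le> K_m * real n"
      "galois_modulus p e d f" "GR = galois_ring p e f"
      "galois_modulus p e (d * m) g" "GRm = galois_ring p e g"
      "extension_of_degree GR GRm \<iota> m \<kappa>" "rmfe GR GRm \<iota> n \<phi> \<psi>"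
      "inj_on \<alpha> {..<N}" "exceptional GRm (\<alpha> ` {..<N})"
      "0 < u" "0 < v" "0 < w" "u dvd t" "v dvd s" "w dvd r" "u * v * w + w - 1 \<le> N"
    for n m N t r s u v w f g GR GRm \<iota> \<kappa> \<phi> \<psi> \<alpha>
  proof -
    have cring: "cring GR" "cring GRm"
      using that(4-7) cring_galois_ring[OF assms(1,2)] by simp_all
    show ?thesis
      by (intro amortized_scheme.intro rmfe_scheme.intro amortized_scheme_axioms.intro cring that
          packing_length_bounds[OF prime_ge_2_nat[OF assms(1)] assms(3) that(1,2)])
  qed
  show ?thesis
  proof (rule exI[of _ ?C], rule exI[of _ 4], rule conjI[OF C(1)], intro allI impI, elim conjE,
      goal_cases)
    case (1 n m N t r s u v w f g GR GRm \<iota> \<kappa> \<phi> \<psi> \<alpha> R)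
    have R: "R = u * v * w + w - 1"
      by (rule 1)
    interpret amortized_scheme GR GRm \<iota> m \<kappa> n \<phi> \<psi> N t r s u v w \<alpha> K_m
      by (rule scheme) (fact 1 | fact 1[unfolded R])+
    show ?case
      unfolding R
      by (intro conjI allI impI recovery upload_amortized[OF C(2)] download_amortized[OF C(2)];
          elim conjE;
          (assumption |
           rule encoding_amortized[OF _ _ _ C(3)] decoding_amortized[OF _ _ _ C(3)]
             worker_amortized[OF _ _ _ C(3)];
           assumption))
  qed
qed

end
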